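(* Let $I=[0,2\pi]$ and let $N\geq 5$, $K\geq 2$, $1\leq l\leq K-1$, $K+1\leq r\leq q-1$, $r+1\leq q\leq N-1$ be integers. For $1\leq k\leq N$ let $G_k:I\to\mathbb{R}$, $G_k\in C(I)$, $G_k(0)=G_k(2\pi)$, and let $a_k\geq 0$ be constants; for $1\leq k\leq K$ let $b_k\in\mathbb{R}$, $b_k\neq 0$. Let $F_k(u,x):\mathbb{R}^N\times I\to\mathbb{R}$, $1\leq k\leq N$, satisfy the Carath\'eodory condition, with $F_k(u,0)=F_k(u,2\pi)$ for all $u\in\mathbb{R}^N$, and $$\sqrt{\sum_{k=1}^N F_k^2(u,x)}\leq\mathcal{K}|u|_{\mathbb{R}^N}+h(x),\quad u\in\mathbb{R}^N,\ x\in I,$$ with a constant $\mathcal{K}>0$ and $h:I\to\mathbb{R}^+$, $h\in L^2(I)$, and $$\sqrt{\sum_{k=1}^N\big(F_k(u^{(1)},x)-F_k(u^{(2)},x)\big)^2}\leq L|u^{(1)}-u^{(2)}|_{\mathbb{R}^N},\quad u^{(1)},u^{(2)}\in\mathbb{R}^N,\ x\in I,$$ with a constant $L>0$. Assume: (a) $a_k>0$ for $1\leq k\leq l$; (b) $a_k=0$ for $l+1\leq k\leq K$, and $\int_0^{2\pi}G_k(x)\,dx=0$ for these $k$; (c) $a_k>0$ and $a_k\neq n^2$ for all $n\in\mathbb{Z}$, for $K+1\leq k\leq r$; (d) $a_k=n_k^2$ with $n_k\in\mathbb{N}$ for $r+1\leq k\leq q$, and $\int_0^{2\pi}G_k(x)e^{\mp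 in_kx}\,dx=0$ (both signs) for these $k$; (e) $a_k=0$ for $q+1\leq k\leq N$, and $\int_0^{2\pi}G_k(x)\,dx=0$ for these $k$; and $2\sqrt{\pi}\,\mathcal{Q}L<1$ with $\mathcal{Q}$ as in the context. For $v\in H^2_c(I,\mathbb{R}^N)$ let $\tau_{a,b}v=u$ be defined by $$-u_k''-b_ku_k'-a_ku_k=\int_0^{2\pi}G_k(x-y)F_k(v_1(y),\dots,v_N(y),y)\,dy,\quad 1\leq k\leq K,$$ $$-u_k''-a_ku_k=\int_0^{2\pi}G_k(x-y)F_k(v_1(y),\dots,v_N(y),y)\,dy,\quad K+1\leq k\leq N.$$ Then the map $v\mapsto\tau_{a,b}v=u$ on $H^2_c(I,\mathbb{R}^N)$ has a unique fixed point $v^{(a,b)}$, which is the only solution in $H^2_c(I,\mathbb{R}^N)$ of the system $$u_k''+b_ku_k'+a_ku_k+\int_0^{2\pi}G_k(x-y)F_k(u_1(y),\dots,u_N(y),y)\,dy=0,\quad 1\leq k\leq K,$$ $$u_k''+a_ku_k+\int_0^{2\pi}G_k(x-y)F_k(u_1(y),\dots,u_N(y),y)\,dy=0,\quad K+1\leq k\leq N.$$ The fixed point $v^{(a,b)}$ does not vanish identically in $I$ provided that for some $1\leq k\leq N$ and some $n\in\mathbb{Z}$ the Fourier coefficients satisfy $G_{k,n}\,F_k(0,x)_n\neq 0$.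
   Context: $|u|_{\mathbb{R}^N}$ is the Euclidean norm. In the convolution integrals, $G_k$ is understood via its $2\pi$-periodic extension. Fourier coefficients on $I$: $G_{k,n}=\int_0^{2\pi}G_k(x)\frac{e^{-inx}}{\sqrt{2\pi}}dx$, $n\in\mathbb{Z}$, and $F_k(0,x)_n$ denotes the analogous coefficient of $x\mapsto F_k(0,x)$. Spaces: $H^2(I)=\{v:I\to\mathbb{R}\mid v,v''\in L^2(I),\ v(0)=v(2\pi),\ v'(0)=v'(2\pi)\}$; $H^2_0(I)=\{v\in H^2(I)\mid\int_0^{2\pi}v\,dx=0\}$; for $r+1\leq k\leq q$, $H^2_k(I)=\{v\in H^2(I)\mid\int_0^{2\pi}v(x)e^{\mp in_kx}dx=0\}$. Then $H^2_c(I,\mathbb{R}^N)=\bigoplus_{k=1}^lH^2(I)\oplus\bigoplus_{k=l+1}^KH^2_0(I)\oplus\bigoplus_{k=K+1}^rH^2(I)\oplus\bigoplus_{k=r+1}^qH^2_k(I)\oplus\bigoplus_{k=q+1}^NH^2_0(I)$ (the $k$-th component lies in the $k$-th summand), with norm $\|u\|^2=\sum_{k=1}^N(\|u_k\|^2_{L^2(I)}+\|u_k''\|^2_{L^2(I)})$. Define $\mathcal{N}_{a,b,k}=\max\{\sup_{n\in\mathbb{Z}}\big|\frac{G_{k,n}}{n^2-a_k-ib_kn}\big|,\sup_{n\in\mathbb{Z}}\big|\frac{n^2G_{k,n}}{n^2-a_k-ib_kn}\big|\}$ for $1\leq k\leq K$, $\mathcal{M}_{a,k}=\max\{\sup_{n\in\mathbb{Z}}\big|\frac{G_{k,n}}{n^2-a_k}\big|,\sup_{n\in\mathbb{Z}}\big|\frac{n^2G_{k,n}}{n^2-a_k}\big|\}$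 for $K+1\leq k\leq N$, where a quotient with vanishing denominator is taken to be $0$ if its numerator vanishes; and $\mathcal{Q}=\max\{\max_{1\leq k\leq K}\mathcal{N}_{a,b,k},\max_{K+1\leq k\leq N}\mathcal{M}_{a,k}\}$ (finite under the hypotheses). *)

theory Defs
  imports "HOL-Analysis.Analysis"
begin

abbreviation Ipi :: "real set" where "Ipi \<equiv> {0..2*pi}"

text \<open>Euclidean norm of the first N components of a vector u in R^N
  (vectors are represented as functions nat => real, components 1..N).\<close>
definition enorm :: "nat \<Rightarrow> (nat \<Rightarrow> real) \<Rightarrow> real" where
  "enorm N u = sqrt (\<Sum>k=1..N. (u k)^2)"

text \<open>L^2(I) (on a bounded interval L^2 is contained in L^1, so we also require
  absolute integrability, which yields measurability).\<close>
definition L2_on :: "(real \<Rightarrow> real) \<Rightarrow> bool" where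
  "L2_on f \<longleftrightarrow> f absolutely_integrable_on Ipi \<and> (\<lambda>x. (f x)^2) integrable_on Ipi"

text \<open>v is in the periodic space H^2(I) with first derivative v1 and second
  (weak) derivative v2 in L^2(I): v is differentiable on I with derivative v1,
  v1 is absolutely continuous with v1(x) = v1(0) + int_0^x v2,
  v(0)=v(2pi), v'(0)=v'(2pi).\<close>
definition H2_with :: "(real \<Rightarrow> real) \<Rightarrow> (real \<Rightarrow> real) \<Rightarrow> (real \<Rightarrow> real) \<Rightarrow> bool" where
  "H2_with v v1 v2 \<longleftrightarrow> L2_on v2
     \<and> (\<forall>x\<in>Ipi. (v has_real_derivative v1 x) (at x within Ipi))
     \<and> (\<forall>x\<in>Ipi. v1 x = v1 0 + integral {0..x} v2)
     \<and> v 0 = v (2*pi) \<and> v1 0 = v1 (2*pi)"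

definition H2 :: "(real \<Rightarrow> real) \<Rightarrow> bool" where
  "H2 v \<longleftrightarrow> (\<exists>v1 v2. H2_with v v1 v2)"

text \<open>H^2_c(I,R^N); nk k is the integer n_k with a_k = n_k^2 for r+1 <= k <= q.\<close>
definition H2c :: "nat \<Rightarrow> nat \<Rightarrow> nat \<Rightarrow> nat \<Rightarrow> nat \<Rightarrow> (nat \<Rightarrow> nat) \<Rightarrow> (nat \<Rightarrow> real \<Rightarrow> real) \<Rightarrow> bool" where
  "H2c N K l r q nk u \<longleftrightarrow>
     (\<forall>k\<in>{1..N}. H2 (u k)
        \<and> (k \<in> {l+1..K} \<union> {q+1..N} \<longrightarrow> integral Ipi (u k) = 0)
        \<and> (k \<in> {r+1..q} \<longrightarrow>
              integral Ipi (\<lambda>x. complex_of_real (u k x) * exp (- \<i> * of_nat (nk k) * of_real x)) = 0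
            \<and> integral Ipi (\<lambda>x. complex_of_real (u k x) * exp (\<i> * of_nat (nk k) * of_real x)) = 0))"

definition per_ext :: "(real \<Rightarrow> real) \<Rightarrow> real \<Rightarrow> real" where
  "per_ext g t = g (t - 2*pi * of_int \<lfloor>t / (2*pi)\<rfloor>)"

definition conv_term :: "(nat \<Rightarrow> real \<Rightarrow> real) \<Rightarrow> (nat \<Rightarrow> (nat \<Rightarrow> real) \<Rightarrow> real \<Rightarrow> real)
     \<Rightarrow> nat \<Rightarrow> (nat \<Rightarrow> real \<Rightarrow> real) \<Rightarrow> real \<Rightarrow> real" where
  "conv_term G F k v x = integral Ipi (\<lambda>y. per_ext (G k) (x - y) * F k (\<lambda>j. v j y) y)"

definition fourier_coeff :: "(real \<Rightarrow> real) \<Rightarrow> int \<Rightarrow> complex" where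
  "fourier_coeff f n = integral Ipi (\<lambda>x. complex_of_real (f x) * exp (- \<i> * of_int n * of_real x)
                                          / complex_of_real (sqrt (2*pi)))"

text \<open>Quotient with the convention that 0/0 = 0 (Isabelle's division by 0 gives 0 anyway).\<close>
definition cquot :: "complex \<Rightarrow> complex \<Rightarrow> complex" where
  "cquot z w = (if w = 0 then 0 else z / w)"

definition N_ab :: "(nat \<Rightarrow> real \<Rightarrow> real) \<Rightarrow> (nat \<Rightarrow> real) \<Rightarrow> (nat \<Rightarrow> real) \<Rightarrow> nat \<Rightarrow> real" where
  "N_ab G a b k = max
     (SUP n::int. cmod (cquot (fourier_coeff (G k) n) (of_int (n^2) - of_real (a k) - \<i> * of_real (b k) * of_int n)))
     (SUP n::int. cmod (cquot (of_int (n^2) * fourier_coeff (G k) n) (of_int (n^2) - of_real (a k) - \<i> * of_real (b k) * of_int n)))"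

definition M_a :: "(nat \<Rightarrow> real \<Rightarrow> real) \<Rightarrow> (nat \<Rightarrow> real) \<Rightarrow> nat \<Rightarrow> real" where
  "M_a G a k = max
     (SUP n::int. cmod (cquot (fourier_coeff (G k) n) (of_int (n^2) - of_real (a k))))
     (SUP n::int. cmod (cquot (of_int (n^2) * fourier_coeff (G k) n) (of_int (n^2) - of_real (a k))))"

definition Qconst :: "nat \<Rightarrow> nat \<Rightarrow> (nat \<Rightarrow> real \<Rightarrow> real) \<Rightarrow> (nat \<Rightarrow> real) \<Rightarrow> (nat \<Rightarrow> real) \<Rightarrow> real" where
  "Qconst N K G a b = max (Max (N_ab G a b ` {1..K})) (Max (M_a G a ` {K+1..N}))"

definition tau_rel :: "nat \<Rightarrow> nat \<Rightarrow> (nat \<Rightarrow> real) \<Rightarrow> (nat \<Rightarrow> real) \<Rightarrow> (nat \<Rightarrow> real \<Rightarrow> real)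
     \<Rightarrow> (nat \<Rightarrow> (nat \<Rightarrow> real) \<Rightarrow> real \<Rightarrow> real) \<Rightarrow> (nat \<Rightarrow> real \<Rightarrow> real) \<Rightarrow> (nat \<Rightarrow> real \<Rightarrow> real) \<Rightarrow> bool" where
  "tau_rel N K a b G F v u \<longleftrightarrow>
     (\<forall>k\<in>{1..N}. \<exists>u1 u2 Z. H2_with (u k) u1 u2 \<and> Z \<in> null_sets lebesgue \<and>
        (\<forall>x\<in>Ipi - Z.
           (k \<le> K \<longrightarrow> - u2 x - b k * u1 x - a k * u k x = conv_term G F k v x) \<and>
           (K < k \<longrightarrow> - u2 x - a k * u k x = conv_term G F k v x)))"

definition solves_system :: "nat \<Rightarrow> nat \<Rightarrow> (nat \<Rightarrow> real) \<Rightarrow> (nat \<Rightarrow> real) \<Rightarrow> (nat \<Rightarrow> real \<Rightarrow> real)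
     \<Rightarrow> (nat \<Rightarrow> (nat \<Rightarrow> real) \<Rightarrow> real \<Rightarrow> real) \<Rightarrow> (nat \<Rightarrow> real \<Rightarrow> real) \<Rightarrow> bool" where
  "solves_system N K a b G F u \<longleftrightarrow>
     (\<forall>k\<in>{1..N}. \<exists>u1 u2 Z. H2_with (u k) u1 u2 \<and> Z \<in> null_sets lebesgue \<and>
        (\<forall>x\<in>Ipi - Z.
           (k \<le> K \<longrightarrow> u2 x + b k * u1 x + a k * u k x + conv_term G F k u x = 0) \<and>
           (K < k \<longrightarrow> u2 x + a k * u k x + conv_term G F k u x = 0)))"

text \<open>Equality of vector functions on I (elements of H^2 are identified on I).\<close>
definition eq_on_I :: "nat \<Rightarrow> (nat \<Rightarrow> real \<Rightarrow> real) \<Rightarrow> (nat \<Rightarrow> real \<Rightarrow> real) \<Rightarrow> bool" where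
  "eq_on_I N u v \<longleftrightarrow> (\<forall>k\<in>{1..N}. \<forall>x\<in>Ipi. u k x = v k x)"

definition caratheodory :: "nat \<Rightarrow> ((nat \<Rightarrow> real) \<Rightarrow> real \<Rightarrow> real) \<Rightarrow> bool" where
  "caratheodory N f \<longleftrightarrow>
     (\<forall>u. (\<lambda>x. f u x) \<in> borel_measurable (lebesgue_on Ipi)) \<and>
     (\<exists>Z \<in> null_sets lebesgue. \<forall>x\<in>Ipi - Z. \<forall>u. \<forall>e>0. \<exists>d>0. \<forall>w.
         enorm N (\<lambda>j. w j - u j) < d \<longrightarrow> \<bar>f w x - f u x\<bar> < e)"

end

theory Submission
  imports Defs
begin

text \<open>
  In Fourier coefficients the linear problem is diagonal: \<open>u\<^sub>n = \<surd>(2\<pi>) G\<^sub>n f\<^sub>n / s(n)\<close> with symbol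
  \<open>s(n) = n\<^sup>2 - a - \<i>bn\<close>, and the orthogonality conditions say precisely that \<open>G\<^sub>n\<close> and \<open>u\<^sub>n\<close> vanish
  at the zeros of \<open>s\<close>. By Bessel's inequality the series of the products \<open>G\<^sub>n f\<^sub>n\<close> converges absolutely,
  so the convolution is continuous and the solution is a classical one, given by an absolutely
  convergent series. Parseval's identity bounds the solution operator on \<open>L\<^sup>2\<close> by \<open>\<surd>(2\<pi>) Q\<close>; hence
  \<open>\<tau>\<close> contracts the \<open>L\<^sup>2\<close> norm with constant \<open>\<surd>(2\<pi>) Q L < 1\<close>. Since the solution operator also maps
  \<open>L\<^sup>2\<close> boundedly into the continuous functions, Picard iteration converges uniformly, and no
  completeness of \<open>H\<^sup>2\<close> is needed. If the fixed point were \<open>0\<close>, then all products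
  \<open>G\<^sub>n F(0,\<cdot>)\<^sub>n\<close> would vanish.
\<close>

section \<open>Fourier coefficients and Bessel's inequality\<close>

text \<open>Neither factor of the convolution has a summable Fourier series: \<open>G k\<close> is
  only continuous and the superposed nonlinearity only square integrable. Hence neither is expanded
  by itself; only products of two coefficient sequences occur. That a convolution equals its series
  is then proved by density: it is a one-term check for each \<open>fexp n\<close>, both sides are
  controlled by the sup norm of the kernel, and Stone-Weierstrass on the unit circle supplies the
  approximants. The same identity yields injectivity of the Fourier coefficients on continuous
  periodic functions. So Parseval is required only for absolutely convergent series, where it is
  termwise integration, while arbitrary L^2 functions enter only through Bessel. The five cases (a)
  to (e) differ only in the zero set of the symbol. With the drift set to 0 for k > K, one linear
  theory covers both kinds of equation.\<close>

definition fexp :: "int \<Rightarrow> real \<Rightarrow> complex" where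
  "fexp n x = cis (of_int n * x)"

lemma fexp_0 [simp]: "fexp 0 x = 1" "fexp n 0 = 1"
  by (simp_all add: fexp_def)

lemma fexp_mult: "fexp m x * fexp n x = fexp (m + n) x"
  by (simp add: fexp_def cis_mult algebra_simps)

lemma fexp_diff: "fexp n (x - y) = fexp n x * fexp (- n) y"
  by (simp add: fexp_def cis_mult algebra_simps)

lemma cnj_fexp [simp]: "cnj (fexp n x) = fexp (- n) x"
  by (simp add: fexp_def cis_cnj)

lemma norm_fexp [simp]: "norm (fexp n x) = 1"
  by (simp add: fexp_def)

lemma fexp_2pi [simp]: "fexp n (2 * pi) = 1"
  unfolding fexp_def by (metis cis_multiple_2pi Ints_of_int mult.commute mult.left_commute)

lemma continuous_on_fexp [continuous_intros]:
  "continuous_on S g \<Longrightarrow> continuous_on S (\<lambda>x. fexp n (g x))"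
  unfolding fexp_def cis_conv_exp by (intro continuous_intros)

lemma fexp_has_vector_derivative:
  "(fexp n has_vector_derivative (\<i> * of_int n * fexp n x)) (at x within S)"
proof -
  have "((\<lambda>z. exp (\<i> * of_int n * z)) has_field_derivative \<i> * of_int n * exp (\<i> * of_int n * of_real x))
      (at (of_real x))"
    by (auto intro!: derivative_eq_intros)
  from has_vector_derivative_real_field[OF this, of S] show ?thesis
    by (simp add: fexp_def[abs_def] cis_conv_exp mult_ac)
qed

lemma exp_eq_fexp: "exp (- \<i> * of_int n * of_real x) = fexp (- n) x"
  by (simp add: fexp_def cis_conv_exp mult_ac)

lemma has_integral_fexp:
  "(fexp n has_integral (if n = 0 then of_real (2 * pi) else 0)) Ipi"
proof (cases "n = 0")
  case True
  then have "fexp n = (\<lambda>x. 1)" by (auto simp: fun_eq_iff)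
  then show ?thesis using has_integral_const_real[of "1::complex" 0 "2*pi"] True
    by (simp add: scaleR_conv_of_real)
next
  case False
  have "((\<lambda>x. fexp n x / (\<i> * of_int n)) has_vector_derivative fexp n x) (at x within S)" for x S
    using has_vector_derivative_divide[OF fexp_has_vector_derivative[of n x S], of "\<i> * of_int n"] False
    by simp
  then have "(fexp n has_integral fexp n (2*pi) / (\<i> * of_int n) - fexp n 0 / (\<i> * of_int n)) Ipi"
    by (intro fundamental_theorem_of_calculus) auto
  then show ?thesis using False by simp
qed

text \<open>Left unnormalised, unlike \<open>fourier_coeff\<close>, so that a convolution has
  exactly the product of the two coefficients; the price is the factor \<open>2*pi\<close> in
  \<open>hat_fexp\<close> and wherever a series is recovered from its coefficients.\<close>

definition hat :: "(real \<Rightarrow> complex) \<Rightarrow> int \<Rightarrow> complex" where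
  "hat f n = integral Ipi (\<lambda>x. f x * fexp (- n) x)"

lemma fourier_coeff_eq_hat:
  "fourier_coeff f n = hat (\<lambda>x. of_real (f x)) n / of_real (sqrt (2*pi))"
  unfolding fourier_coeff_def hat_def exp_eq_fexp by simp

lemma hat_fexp: "hat (fexp m) n = (if n = m then of_real (2 * pi) else 0)"
  unfolding hat_def fexp_mult using has_integral_fexp[of "m + - n"]
  by (auto simp: integral_unique)

lemma absolutely_integrable_cont_mult:
  fixes f :: "real \<Rightarrow> real" and g :: "real \<Rightarrow> complex"
  assumes "f absolutely_integrable_on Ipi" "continuous_on Ipi g"
  shows "(\<lambda>x. g x * of_real (f x)) absolutely_integrable_on Ipi"
proof -
  have "(\<lambda>x. f x *\<^sub>R g x) = (\<lambda>x. g x * of_real (f x))"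
    by (simp add: scaleR_conv_of_real mult.commute)
  moreover have "(\<lambda>x. (\<lambda>u v. v *\<^sub>R u) (g x) (f x)) absolutely_integrable_on Ipi"
  proof (rule absolutely_integrable_bounded_measurable_product[where h = "\<lambda>u v. v *\<^sub>R u"])
    show "bilinear (\<lambda>(u::complex) (v::real). v *\<^sub>R u)"
      by (auto simp: bilinear_def linear_iff algebra_simps)
    show "g \<in> borel_measurable (lebesgue_on Ipi)"
      using assms(2) by (intro continuous_imp_measurable_on_sets_lebesgue) auto
    show "bounded (g ` Ipi)"
      using assms(2) by (intro compact_imp_bounded compact_continuous_image) auto
  qed (use assms in auto)
  ultimately show ?thesis by simp
qed

lemma integrable_cont_mult:
  fixes f :: "real \<Rightarrow> real" and g :: "real \<Rightarrow> complex"
  assumes "L2_on f" "continuous_on Ipi g"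
  shows "(\<lambda>x. g x * of_real (f x)) integrable_on Ipi"
        "(\<lambda>x. of_real (f x) * g x) integrable_on Ipi"
  using absolutely_integrable_cont_mult[of f g] assms
  by (auto simp: L2_on_def mult.commute intro: set_lebesgue_integral_eq_integral)

lemma integral_of_real_complex:
  "f integrable_on S \<Longrightarrow> integral S (\<lambda>x. complex_of_real (f x)) = of_real (integral S f)"
  using integral_linear[OF _ bounded_linear_of_real, of f S] by (simp add: o_def)

lemma L2_on_continuous: "continuous_on Ipi f \<Longrightarrow> L2_on f"
  unfolding L2_on_def
  by (auto intro!: absolutely_integrable_continuous_real integrable_continuous_real continuous_intros)

lemma hat_has_integral:
  assumes "L2_on f"
  shows "((\<lambda>x. of_real (f x) * fexp (- n) x) has_integral hat (\<lambda>x. of_real (f x)) n) Ipi"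
  unfolding hat_def using assms
  by (intro integrable_integral integrable_cont_mult continuous_intros)

text \<open>The integral of |f - p|^2 is nonnegative for the partial sum \<open>p\<close> over
  \<open>A\<close>. As \<open>p\<close> has the coefficients of \<open>f\<close> on
  \<open>A\<close>, the integral of \<open>f\<close> against \<open>p\<close> and that of |p|^2 are
  both \<open>S / (2*pi)\<close>.\<close>

lemma bessel_finite:
  assumes f: "L2_on f" and A: "finite A"
  shows "(\<Sum>n\<in>A. (cmod (hat (\<lambda>x. of_real (f x)) n))\<^sup>2) \<le> 2 * pi * integral Ipi (\<lambda>x. (f x)\<^sup>2)"
proof -
  define c where "c n = hat (\<lambda>x. of_real (f x)) n / of_real (2*pi)" for n
  define p where "p x = (\<Sum>n\<in>A. c n * fexp n x)" for x
  define S where "S = (\<Sum>n\<in>A. (cmod (hat (\<lambda>x. of_real (f x)) n))\<^sup>2)"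
  have cS: "(\<Sum>n\<in>A. hat (\<lambda>x. of_real (f x)) n * cnj (c n)) = of_real (S / (2*pi))"
    unfolding S_def of_real_sum sum_divide_distrib
    by (intro sum.cong) (auto simp: c_def complex_norm_square[symmetric])
  have hp: "((\<lambda>x. p x * fexp (- m) x) has_integral hat (\<lambda>x. of_real (f x)) m) Ipi" if "m \<in> A" for m
  proof -
    have "((\<lambda>x. \<Sum>n\<in>A. c n * fexp (n - m) x) has_integral
        (\<Sum>n\<in>A. c n * (if n - m = 0 then of_real (2 * pi) else 0))) Ipi"
      using A by (intro has_integral_sum has_integral_mult_right has_integral_fexp)
    moreover have "(\<Sum>n\<in>A. c n * (if n - m = 0 then of_real (2 * pi) else 0))
        = hat (\<lambda>x. of_real (f x)) m"
      using A that by (simp add: if_distrib sum.delta c_def cong: if_cong)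
    moreover have "(\<lambda>x. \<Sum>n\<in>A. c n * fexp (n - m) x) = (\<lambda>x. p x * fexp (- m) x)"
      by (auto simp: p_def sum_distrib_right mult.assoc fexp_mult)
    ultimately show ?thesis by simp
  qed
  have cnjp: "cnj (p x) = (\<Sum>n\<in>A. cnj (c n) * fexp (- n) x)" for x
    by (simp add: p_def)
  have I1: "((\<lambda>x. \<Sum>n\<in>A. cnj (c n) * (of_real (f x) * fexp (- n) x)) has_integral
      (\<Sum>n\<in>A. cnj (c n) * hat (\<lambda>x. of_real (f x)) n)) Ipi"
    using A f by (intro has_integral_sum has_integral_mult_right hat_has_integral)
  have I2: "((\<lambda>x. \<Sum>n\<in>A. cnj (c n) * (p x * fexp (- n) x)) has_integral
      (\<Sum>n\<in>A. cnj (c n) * hat (\<lambda>x. of_real (f x)) n)) Ipi"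
    using A hp by (intro has_integral_sum has_integral_mult_right)
  have cS': "(\<Sum>n\<in>A. cnj (c n) * hat (\<lambda>x. of_real (f x)) n) = of_real (S / (2*pi))"
    using cS by (simp only: mult.commute)
  have eq1: "(\<lambda>x. \<Sum>n\<in>A. cnj (c n) * (of_real (f x) * fexp (- n) x)) = (\<lambda>x. of_real (f x) * cnj (p x))"
    by (simp add: cnjp sum_distrib_left mult_ac)
  have J1: "((\<lambda>x. f x * Re (p x)) has_integral S / (2*pi)) Ipi"
    using has_integral_Re[OF I1[unfolded eq1 cS']] by simp
  have eq2: "(\<lambda>x. \<Sum>n\<in>A. cnj (c n) * (p x * fexp (- n) x)) = (\<lambda>x. p x * cnj (p x))"
    by (simp add: cnjp sum_distrib_left mult_ac)
  have J2: "((\<lambda>x. Re (p x * cnj (p x))) has_integral S / (2*pi)) Ipi"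
    using has_integral_Re[OF I2[unfolded eq2 cS']] by (simp only: Re_complex_of_real)
  have J3: "((\<lambda>x. (f x)\<^sup>2) has_integral integral Ipi (\<lambda>x. (f x)\<^sup>2)) Ipi"
    using f by (auto simp: L2_on_def)
  have J: "((\<lambda>x. (f x)\<^sup>2 - 2 * (f x * Re (p x)) + Re (p x * cnj (p x))) has_integral
      integral Ipi (\<lambda>x. (f x)\<^sup>2) - 2 * (S / (2*pi)) + S / (2*pi)) Ipi"
    by (intro has_integral_add has_integral_diff has_integral_mult_right J1 J2 J3)
  have "(f x)\<^sup>2 - 2 * (f x * Re (p x)) + Re (p x * cnj (p x)) = (cmod (of_real (f x) - p x))\<^sup>2" for x
    unfolding cmod_power2 by (simp add: power2_eq_square algebra_simps)
  then have "0 \<le> integral Ipi (\<lambda>x. (f x)\<^sup>2) - 2 * (S / (2*pi)) + S / (2*pi)"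
    by (intro has_integral_nonneg[OF J]) simp
  then have "S / (2*pi) \<le> integral Ipi (\<lambda>x. (f x)\<^sup>2)" by simp
  then show ?thesis unfolding S_def[symmetric] by (simp add: field_simps)
qed

lemma bessel:
  assumes f: "L2_on f"
  shows "(\<lambda>n. (cmod (hat (\<lambda>x. of_real (f x)) n))\<^sup>2) summable_on UNIV"
    and "(\<Sum>\<^sub>\<infinity>n. (cmod (hat (\<lambda>x. of_real (f x)) n))\<^sup>2) \<le> 2 * pi * integral Ipi (\<lambda>x. (f x)\<^sup>2)"
proof -
  show *: "(\<lambda>n. (cmod (hat (\<lambda>x. of_real (f x)) n))\<^sup>2) summable_on UNIV"
    using bessel_finite[OF f]
    by (intro nonneg_bdd_above_summable_on bdd_aboveI2) auto
  show "(\<Sum>\<^sub>\<infinity>n. (cmod (hat (\<lambda>x. of_real (f x)) n))\<^sup>2) \<le> 2 * pi * integral Ipi (\<lambda>x. (f x)\<^sup>2)"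
    using bessel_finite[OF f] by (intro infsum_le_finite_sums *) auto
qed

text \<open>Cauchy-Schwarz for sequences on top of Bessel. Every absolutely convergent solution or
  convolution series below owes its summability to this bound, without any decay of the single
  factors.\<close>

lemma bessel_product:
  assumes f: "L2_on f" and g: "L2_on g"
  shows "(\<lambda>n. cmod (hat (\<lambda>x. of_real (f x)) n) * cmod (hat (\<lambda>x. of_real (g x)) n)) summable_on UNIV"
    and "(\<Sum>\<^sub>\<infinity>n. cmod (hat (\<lambda>x. of_real (f x)) n) * cmod (hat (\<lambda>x. of_real (g x)) n))
      \<le> 2 * pi * sqrt (integral Ipi (\<lambda>x. (f x)\<^sup>2)) * sqrt (integral Ipi (\<lambda>x. (g x)\<^sup>2))"
proof -
  let ?f = "\<lambda>n. cmod (hat (\<lambda>x. of_real (f x)) n)" and ?g = "\<lambda>n. cmod (hat (\<lambda>x. of_real (g x)) n)"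
  have fin: "(\<Sum>n\<in>A. ?f n * ?g n)
      \<le> 2 * pi * sqrt (integral Ipi (\<lambda>x. (f x)\<^sup>2)) * sqrt (integral Ipi (\<lambda>x. (g x)\<^sup>2))"
    if "finite A" for A
  proof -
    have "(\<Sum>n\<in>A. ?f n * ?g n) \<le> L2_set ?f A * L2_set ?g A"
      using L2_set_mult_ineq[of ?f ?g A] by simp
    also have "\<dots> \<le> sqrt (2 * pi * integral Ipi (\<lambda>x. (f x)\<^sup>2)) * sqrt (2 * pi * integral Ipi (\<lambda>x. (g x)\<^sup>2))"
      unfolding L2_set_def using bessel_finite[OF f that] bessel_finite[OF g that]
      by (intro mult_mono real_sqrt_le_mono) (auto simp: sum_nonneg intro!: integral_nonneg mult_nonneg_nonneg f[unfolded L2_on_def, THEN conjunct2] g[unfolded L2_on_def, THEN conjunct2])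
    also have "\<dots> = (sqrt (2 * pi))\<^sup>2 * sqrt (integral Ipi (\<lambda>x. (f x)\<^sup>2)) * sqrt (integral Ipi (\<lambda>x. (g x)\<^sup>2))"
      unfolding power2_eq_square by (simp add: real_sqrt_mult)
    finally show ?thesis by simp
  qed
  show *: "(\<lambda>n. ?f n * ?g n) summable_on UNIV"
    using fin by (intro nonneg_bdd_above_summable_on bdd_aboveI2) auto
  show "(\<Sum>\<^sub>\<infinity>n. ?f n * ?g n)
      \<le> 2 * pi * sqrt (integral Ipi (\<lambda>x. (f x)\<^sup>2)) * sqrt (integral Ipi (\<lambda>x. (g x)\<^sup>2))"
    using fin by (intro infsum_le_finite_sums *) auto
qed

section \<open>The Fourier expansion of a convolution\<close>

text \<open>Trades periodicity for continuity on a compact set: \<open>H\<close> lives on the unit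
  circle, where Stone-Weierstrass applies and where \<open>cis (x - y)\<close> replaces the case
  distinctions of \<open>per_ext\<close>.\<close>

lemma periodic_factors_through_circle:
  fixes G :: "real \<Rightarrow> real"
  assumes "continuous_on Ipi G" "G 0 = G (2*pi)"
  obtains H where "continuous_on (sphere 0 1) H" "\<And>t. t \<in> Ipi \<Longrightarrow> H (cis t) = G t"
    "\<And>t. per_ext G t = H (cis t)"
proof -
  define H where "H z = G (Arg2pi z)" for z
  have H: "H (cis t) = G t" if t: "t \<in> Ipi" for t
  proof (cases "t = 2*pi")
    case True
    then have "Arg2pi (cis t) = 0"
      using Arg2pi_unique[of 1 0 "cis t"] by (simp add: complex_eq_iff)
    with True assms show ?thesis by (simp add: H_def)
  next
    case False
    then have "Arg2pi (cis t) = t"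
      using t Arg2pi_unique[of 1 t "cis t"] by (auto simp: cis_conv_exp)
    then show ?thesis by (simp add: H_def)
  qed
  have img: "cis ` Ipi = sphere 0 1"
  proof
    show "sphere 0 1 \<subseteq> cis ` Ipi"
    proof
      fix z :: complex assume "z \<in> sphere 0 1"
      then have "z = cis (Arg2pi z)" using Arg2pi_eq[of z] by (simp add: cis_conv_exp)
      moreover have "Arg2pi z \<in> Ipi" using Arg2pi_ge_0[of z] Arg2pi_lt_2pi[of z] by simp
      ultimately show "z \<in> cis ` Ipi" by blast
    qed
  qed auto
  \<comment> \<open>A continuous surjection from a compact space onto a Hausdorff space is a
    quotient map, so continuity of \<open>H\<close> may be tested after composition with
    \<open>cis\<close>, where it is that of \<open>G\<close>.\<close>
  have q: "quotient_map (top_of_set Ipi) (top_of_set (sphere 0 1)) cis"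
  proof (rule T1_Spaces.continuous_imp_quotient_map)
    show "continuous_map (top_of_set Ipi) (top_of_set (sphere 0 1)) cis"
      by (auto simp: cis_conv_exp intro!: continuous_intros)
  qed (use img in \<open>auto simp: compact_space_subtopology Hausdorff_space_subtopology\<close>)
  have "continuous_map (top_of_set Ipi) euclidean (H \<circ> cis)"
    using assms(1) continuous_on_cong[of Ipi Ipi "H \<circ> cis" G] H by simp
  then have "continuous_map (top_of_set (sphere 0 1)) euclidean H"
    by (rule continuous_compose_quotient_map[OF q])
  then have "continuous_on (sphere 0 1) H"
    by simp
  moreover have "per_ext G t = H (cis t)" for t
  proof -
    let ?t = "t - 2*pi * of_int \<lfloor>t / (2*pi)\<rfloor>"
    have "of_int \<lfloor>t / (2*pi)\<rfloor> \<le> t / (2*pi)" "t / (2*pi) < of_int \<lfloor>t / (2*pi)\<rfloor> + 1"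
      by linarith+
    then have "of_int \<lfloor>t / (2*pi)\<rfloor> * (2*pi) \<le> t" "t < (of_int \<lfloor>t / (2*pi)\<rfloor> + 1) * (2*pi)"
      by (simp_all only: pos_le_divide_eq pos_divide_less_eq pi_gt_zero mult_pos_pos zero_less_numeral)
    then have "?t \<in> Ipi" by (auto simp: algebra_simps)
    moreover have "cis ?t = cis t"
      by (simp add: cis_divide[symmetric] mult.assoc[symmetric] cis_multiple_2pi)
    ultimately show ?thesis unfolding per_ext_def using H[of ?t] by simp
  qed
  ultimately show ?thesis using that H by blast
qed

section \<open>Trigonometric polynomials and their convolutions\<close>

inductive trigpoly :: "(real \<Rightarrow> complex) \<Rightarrow> bool" where
  fexp: "trigpoly (fexp n)"
| scale: "trigpoly p \<Longrightarrow> trigpoly (\<lambda>x. c * p x)"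
| add: "trigpoly p \<Longrightarrow> trigpoly q \<Longrightarrow> trigpoly (\<lambda>x. p x + q x)"

lemma trigpoly_mult:
  assumes "trigpoly p" "trigpoly q"
  shows "trigpoly (\<lambda>x. p x * q x)"
  using assms(1)
proof induction
  case (fexp n)
  show ?case using assms(2)
  proof induction
    case (fexp m)
    then show ?case unfolding fexp_mult by (rule trigpoly.fexp)
  next
    case (scale q c)
    from trigpoly.scale[OF scale(2), of c] show ?case by (simp add: mult_ac)
  next
    case (add p q)
    then show ?case by (simp add: distrib_left trigpoly.add)
  qed
next
  case (scale p c)
  from trigpoly.scale[OF scale(2), of c] show ?case by (simp add: mult_ac)
next
  case (add p q)
  then show ?case by (simp add: distrib_right trigpoly.add)
qed

text \<open>On the circle a real-linear form in Re and Im is a combination of \<open>fexp 1\<close>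
  and \<open>fexp (-1)\<close>, and products stay in the class. This converts Stone-Weierstrass
  approximants into trigonometric polynomials.\<close>

lemma trigpoly_real_polynomial:
  assumes "real_polynomial_function p"
  shows "trigpoly (\<lambda>x. of_real (p (cis x)))"
  using assms
proof induction
  case (linear h)
  then have lin: "linear h" by (simp add: bounded_linear.linear)
  have hz: "h z = Re z * h 1 + Im z * h \<i>" for z
  proof -
    have "z = Re z *\<^sub>R 1 + Im z *\<^sub>R \<i>" by (simp add: complex_eq_iff)
    then have "h z = h (Re z *\<^sub>R 1 + Im z *\<^sub>R \<i>)" by simp
    then show ?thesis by (simp only: linear_add[OF lin] linear_scale[OF lin] real_scaleR_def)
  qed
  define A where "A = (of_real (h 1) - \<i> * of_real (h \<i>)) / 2"
  have "of_real (h (cis x)) = A * fexp 1 x + cnj A * fexp (-1) x" for x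
    unfolding A_def hz[of "cis x"] by (auto simp: fexp_def complex_eq_iff field_simps)
  then show ?case by (simp add: trigpoly.intros)
next
  case (const c)
  from trigpoly.scale[OF trigpoly.fexp[of 0], of "of_real c"] show ?case by simp
next
  case (add f g)
  then show ?case by (simp add: trigpoly.add)
next
  case (mult f g)
  then show ?case by (simp add: trigpoly_mult)
qed

lemma continuous_on_trigpoly: "trigpoly p \<Longrightarrow> continuous_on S p"
proof (induction rule: trigpoly.induct)
  case (fexp n)
  show ?case using continuous_on_fexp[OF continuous_on_id[of S], of n] by simp
qed (intro continuous_intros; assumption)+

lemma hat_add:
  assumes "continuous_on Ipi f" "continuous_on Ipi g"
  shows "hat (\<lambda>x. f x + g x) n = hat f n + hat g n"
  unfolding hat_def distrib_right
  by (intro integral_add integrable_continuous_real continuous_intros assms)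

lemma hat_cmult: "hat (\<lambda>x. c * f x) n = c * hat f n"
  unfolding hat_def by (simp add: mult.assoc)

lemma hat_diff:
  assumes "L2_on f" "L2_on g"
  shows "hat (\<lambda>x. of_real (f x - g x)) n = hat (\<lambda>x. of_real (f x)) n - hat (\<lambda>x. of_real (g x)) n"
proof -
  have "((\<lambda>x. of_real (f x) * fexp (- n) x - of_real (g x) * fexp (- n) x) has_integral
      hat (\<lambda>x. of_real (f x)) n - hat (\<lambda>x. of_real (g x)) n) Ipi"
    by (intro has_integral_diff hat_has_integral assms)
  then have "((\<lambda>x. of_real (f x - g x) * fexp (- n) x) has_integral
      hat (\<lambda>x. of_real (f x)) n - hat (\<lambda>x. of_real (g x)) n) Ipi"
    by (simp only: of_real_diff left_diff_distrib)
  then show ?thesis unfolding hat_def[of "\<lambda>x. of_real (f x - g x)"] by (rule integral_unique)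
qed

lemma L2_on_cont_shift_mult:
  fixes P :: "real \<Rightarrow> complex"
  assumes "L2_on f" "continuous_on UNIV P"
  shows "(\<lambda>y. P (x - y) * of_real (f y)) integrable_on Ipi"
proof -
  have "continuous_on Ipi (\<lambda>y. P (x - y))"
    by (rule continuous_on_compose2[OF assms(2)]) (auto intro!: continuous_intros)
  from integrable_cont_mult(1)[OF assms(1) this] show ?thesis .
qed

text \<open>Linear in \<open>P\<close>, so \<open>P = fexp m\<close> decides: there the kernel
  splits as \<open>fexp m x * fexp (- m) y\<close>, and only the term n = m of the sum
  survives.\<close>

lemma trigpoly_conv:
  assumes f: "L2_on f" and P: "trigpoly P"
  shows "((\<lambda>n. hat P n * hat (\<lambda>y. of_real (f y)) n * fexp n x) has_sum
      of_real (2*pi) * integral Ipi (\<lambda>y. P (x - y) * of_real (f y))) UNIV"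
  using P
proof induction
  case (fexp m)
  let ?t = "of_real (2*pi) * (hat (\<lambda>y. of_real (f y)) m * fexp m x)"
  have "((\<lambda>n. hat (fexp m) n * hat (\<lambda>y. of_real (f y)) n * fexp n x) has_sum ?t) UNIV
      \<longleftrightarrow> ((\<lambda>n. ?t) has_sum ?t) {m}"
    by (rule has_sum_cong_neutral) (auto simp: hat_fexp)
  moreover have "of_real (2*pi) * integral Ipi (\<lambda>y. fexp m (x - y) * of_real (f y)) = ?t"
  proof -
    have "(\<lambda>y. fexp m (x - y) * of_real (f y)) = (\<lambda>y. fexp m x * (of_real (f y) * fexp (- m) y))"
      by (simp add: fexp_diff mult_ac)
    then show ?thesis unfolding hat_def by (simp only: integral_mult_right) (simp only: mult.commute)
  qed
  moreover have "((\<lambda>n. ?t) has_sum ?t) {m}" by (rule has_sum_finiteI) auto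
  ultimately show ?case by simp
next
  case (scale p c)
  from has_sum_cmult_right[OF scale(2), of c] show ?case
    by (simp add: hat_cmult mult.assoc mult.left_commute)
next
  case (add p q)
  have "integral Ipi (\<lambda>y. (p (x - y) + q (x - y)) * of_real (f y))
      = integral Ipi (\<lambda>y. p (x - y) * of_real (f y)) + integral Ipi (\<lambda>y. q (x - y) * of_real (f y))"
    unfolding distrib_right
    by (intro integral_add L2_on_cont_shift_mult[OF f] continuous_on_trigpoly add)
  moreover have "hat (\<lambda>x. p x + q x) n = hat p n + hat q n" for n
    by (intro hat_add continuous_on_trigpoly add)
  ultimately show ?case using has_sum_add[OF add(3,4)] by (simp add: distrib_left distrib_right)
qed

lemma hat_product_summable:
  assumes "L2_on f" "L2_on g"
  shows "(\<lambda>n. norm (hat (\<lambda>y. of_real (f y)) n * hat (\<lambda>y. of_real (g y)) n * fexp n x)) summable_on UNIV"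
  using bessel_product(1)[OF assms] by (simp add: norm_mult)

text \<open>The integral side \<open>J\<close> and the series side \<open>S\<close> agree on
  trigonometric polynomials, and each is Lipschitz in \<open>H\<close> for the sup norm on the
  circle; density does the rest. No sum is exchanged with an integral for \<open>H\<close>
  itself.\<close>

lemma convolution_expansion:
  fixes H :: "complex \<Rightarrow> real"
  assumes H: "continuous_on (sphere 0 1) H" and f: "L2_on f"
  shows "((\<lambda>n. hat (\<lambda>t. of_real (H (cis t))) n * hat (\<lambda>y. of_real (f y)) n * fexp n x) has_sum
      of_real (2*pi * integral Ipi (\<lambda>y. H (cis (x - y)) * f y))) UNIV"
proof -
  let ?f = "hat (\<lambda>y. of_real (f y))"
  have contH: "continuous_on S (\<lambda>t. H' (cis t))" if "continuous_on (sphere 0 1) H'" for S and H' :: "complex \<Rightarrow> real"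
    by (rule continuous_on_compose2[OF that]) (auto simp: cis_conv_exp intro!: continuous_intros)
  note L2H = L2_on_continuous[OF contH]
  have intH: "(\<lambda>y. H' (cis (x - y)) * f y) absolutely_integrable_on Ipi"
    if "continuous_on (sphere 0 1) H'" for H' :: "complex \<Rightarrow> real"
  proof -
    have c: "continuous_on Ipi (\<lambda>y. H' (cis (x - y)))"
      by (rule continuous_on_compose2[OF that]) (auto simp: cis_conv_exp intro!: continuous_intros)
    show ?thesis
      using f c
      by (intro absolutely_integrable_bounded_measurable_product_real)
         (auto simp: L2_on_def intro!: continuous_imp_measurable_on_sets_lebesgue
            compact_imp_bounded compact_continuous_image)
  qed
  define S where "S H' = (\<Sum>\<^sub>\<infinity>n. hat (\<lambda>t. of_real (H' (cis t))) n * ?f n * fexp n x)"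
    for H' :: "complex \<Rightarrow> real"
  have hs: "((\<lambda>n. hat (\<lambda>t. of_real (H' (cis t))) n * ?f n * fexp n x) has_sum S H') UNIV"
    if "continuous_on (sphere 0 1) H'" for H'
    unfolding S_def by (rule has_sum_infsum[OF abs_summable_summable[OF hat_product_summable[OF L2H[OF that] f]]])
  define J where "J H' = 2*pi * integral Ipi (\<lambda>y. H' (cis (x - y)) * f y)" for H' :: "complex \<Rightarrow> real"
  \<comment> \<open>The two summands are the Lipschitz constants of \<open>J\<close> and
    \<open>S\<close>. The second comes from \<open>bessel_product\<close> applied to
    \<open>H - p\<close>, whose L^2 norm is at most \<open>e * sqrt (2*pi)\<close>.\<close>
  define C where "C = 2*pi * integral Ipi (\<lambda>y. \<bar>f y\<bar>) + 2*pi * sqrt (2*pi) * sqrt (integral Ipi (\<lambda>x. (f x)\<^sup>2))"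
  have absf: "(\<lambda>y. \<bar>f y\<bar>) integrable_on Ipi" "0 \<le> integral Ipi (\<lambda>x. (f x)\<^sup>2)"
    using f by (auto simp: L2_on_def absolutely_integrable_on_def intro!: integral_nonneg)
  have C0: "C \<ge> 0" unfolding C_def
    using absf by (intro add_nonneg_nonneg mult_nonneg_nonneg integral_nonneg) auto
  have est: "cmod (of_real (J H) - S H) \<le> e * C" if e: "e > 0" for e
  proof -
    obtain p where p: "real_polynomial_function p" "\<And>z. z \<in> sphere 0 1 \<Longrightarrow> \<bar>H z - p z\<bar> < e"
      using Stone_Weierstrass_real_polynomial_function[OF compact_sphere H e] by metis
    have pc: "continuous_on (sphere 0 1) p"
      using p(1) continuous_on_polymonial_function real_polynomial_function_eq by blast
    have dc: "continuous_on (sphere 0 1) (\<lambda>z. H z - p z)"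
      by (intro continuous_intros H pc)
    have less: "\<bar>H (cis t) - p (cis t)\<bar> \<le> e" for t
      using p(2)[of "cis t"] by simp
    have "((\<lambda>n. hat (\<lambda>t. of_real (p (cis t))) n * ?f n * fexp n x) has_sum of_real (J p)) UNIV"
    proof -
      have "of_real (2*pi) * integral Ipi (\<lambda>y. of_real (p (cis (x - y))) * of_real (f y)) = complex_of_real (J p)"
        using intH[OF pc] unfolding J_def of_real_mult[symmetric]
        by (subst integral_of_real_complex) (auto intro: set_lebesgue_integral_eq_integral)
      then show ?thesis using trigpoly_conv[OF f trigpoly_real_polynomial[OF p(1)], of x] by simp
    qed
    then have Sp: "S p = of_real (J p)" using hs[OF pc] has_sum_unique by blast
    have "J H - J p = 2*pi * integral Ipi (\<lambda>y. (H (cis (x - y)) - p (cis (x - y))) * f y)"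
      unfolding J_def right_diff_distrib[symmetric] left_diff_distrib
      using intH[OF H] intH[OF pc]
      by (subst integral_diff) (auto intro: set_lebesgue_integral_eq_integral)
    also have "\<bar>\<dots>\<bar> \<le> 2*pi * integral Ipi (\<lambda>y. e * \<bar>f y\<bar>)"
    proof -
      have "norm (integral Ipi (\<lambda>y. (H (cis (x - y)) - p (cis (x - y))) * f y)) \<le> integral Ipi (\<lambda>y. e * \<bar>f y\<bar>)"
        using intH[OF dc] absf less
        by (intro integral_norm_bound_integral)
           (auto simp: abs_mult intro!: mult_right_mono integrable_on_mult_right intro: set_lebesgue_integral_eq_integral)
      then show ?thesis by (simp add: abs_mult)
    qed
    finally have b1: "\<bar>J H - J p\<bar> \<le> e * (2*pi * integral Ipi (\<lambda>y. \<bar>f y\<bar>))" by (simp add: mult_ac)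
    have "((\<lambda>n. hat (\<lambda>t. of_real (H (cis t) - p (cis t))) n * ?f n * fexp n x) has_sum S H - S p) UNIV"
      using has_sum_add[OF hs[OF H] has_sum_uminusI[OF hs[OF pc]]]
      by (simp only: add_uminus_conv_diff hat_diff[OF L2H[OF H] L2H[OF pc]] left_diff_distrib)
    then have "S H - S p = (\<Sum>\<^sub>\<infinity>n. hat (\<lambda>t. of_real (H (cis t) - p (cis t))) n * ?f n * fexp n x)"
      by (simp add: infsumI)
    also have "norm \<dots> \<le> (\<Sum>\<^sub>\<infinity>n. norm (hat (\<lambda>t. of_real (H (cis t) - p (cis t))) n * ?f n * fexp n x))"
      by (intro norm_infsum_bound hat_product_summable L2H[OF dc] f)
    also have "\<dots> \<le> 2*pi * sqrt (integral Ipi (\<lambda>t. (H (cis t) - p (cis t))\<^sup>2)) * sqrt (integral Ipi (\<lambda>x. (f x)\<^sup>2))"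
      using bessel_product(2)[OF L2H[OF dc] f] by (simp add: norm_mult)
    also have "\<dots> \<le> 2*pi * (e * sqrt (2*pi)) * sqrt (integral Ipi (\<lambda>x. (f x)\<^sup>2))"
    proof -
      have "integral Ipi (\<lambda>t. (H (cis t) - p (cis t))\<^sup>2) \<le> integral Ipi (\<lambda>t. e\<^sup>2)"
        using L2H[OF dc] less e by (intro integral_le) (auto simp: L2_on_def abs_le_square_iff[symmetric])
      then have "sqrt (integral Ipi (\<lambda>t. (H (cis t) - p (cis t))\<^sup>2)) \<le> e * sqrt (2*pi)"
        using e by (intro real_le_lsqrt) (auto simp: power_mult_distrib intro: order_trans)
      then show ?thesis using absf by (intro mult_right_mono mult_left_mono) auto
    qed
    finally have b2: "cmod (S H - S p) \<le> e * (2*pi * sqrt (2*pi) * sqrt (integral Ipi (\<lambda>x. (f x)\<^sup>2)))"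
      by (simp add: mult_ac)
    have "of_real (J H) - S H = of_real (J H - J p) - (S H - S p)" by (simp add: Sp)
    then have "cmod (of_real (J H) - S H) \<le> \<bar>J H - J p\<bar> + cmod (S H - S p)"
      by (metis norm_triangle_ineq4 norm_of_real)
    with b1 b2 show ?thesis by (simp add: C_def distrib_left)
  qed
  have "cmod (of_real (J H) - S H) \<le> 0"
  proof (rule field_le_epsilon)
    fix e :: real assume "e > 0"
    have "e / (C + 1) * C \<le> e" using \<open>e > 0\<close> C0 by (simp add: field_simps)
    with est[of "e / (C + 1)"] \<open>e > 0\<close> C0 show "cmod (of_real (J H) - S H) \<le> 0 + e" by simp
  qed
  then have "S H = of_real (J H)" by simp
  with hs[OF H] show ?thesis by (simp add: J_def)
qed

section \<open>Absolutely convergent Fourier series\<close>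

definition fser :: "(int \<Rightarrow> complex) \<Rightarrow> real \<Rightarrow> complex" where
  "fser c x = (\<Sum>\<^sub>\<infinity>n. c n * fexp n x)"

lemma fser_has_sum:
  assumes "(\<lambda>n. norm (c n)) summable_on UNIV"
  shows "((\<lambda>n. c n * fexp n x) has_sum fser c x) UNIV"
  unfolding fser_def
  by (rule has_sum_infsum[OF abs_summable_summable]) (use assms in \<open>simp add: norm_mult\<close>)

lemma norm_fser_le:
  assumes "(\<lambda>n. norm (c n)) summable_on UNIV"
  shows "norm (fser c x) \<le> (\<Sum>\<^sub>\<infinity>n. norm (c n))"
  using norm_infsum_bound[of "\<lambda>n. c n * fexp n x" UNIV] assms
  by (simp add: fser_def norm_mult)

lemma fser_uniform_limit:
  assumes "(\<lambda>n. norm (c n)) summable_on UNIV"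
  shows "uniform_limit X (\<lambda>A x. \<Sum>n\<in>A. c n * fexp n x) (fser c) (finite_subsets_at_top UNIV)"
  unfolding fser_def[abs_def]
  by (rule Weierstrass_m_test_general[where M = "\<lambda>n. norm (c n)"]) (use assms in \<open>auto simp: norm_mult\<close>)

lemma continuous_on_fser:
  assumes "(\<lambda>n. norm (c n)) summable_on UNIV"
  shows "continuous_on X (fser c)"
  by (rule uniform_limit_theorem[OF _ fser_uniform_limit[OF assms]])
     (auto intro!: always_eventually continuous_intros)

text \<open>The series converges uniformly along the net of finite index sets, so it may be
  integrated term by term. Coefficients, derivatives and Parseval for \<open>fser c\<close> are
  obtained by choosing \<open>g\<close> as \<open>fexp (- n)\<close>, as 1 and as the conjugate of
  \<open>fser c\<close>.\<close>

lemma fser_integral_has_sum: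
  assumes c: "(\<lambda>n. norm (c n)) summable_on UNIV" and g: "continuous_on {a..b} g"
  shows "((\<lambda>n. c n * integral {a..b} (\<lambda>x. fexp n x * g x)) has_sum
      integral {a..b} (\<lambda>x. fser c x * g x)) UNIV"
proof -
  have u: "uniform_limit {a..b} (\<lambda>A x. (\<Sum>n\<in>A. c n * fexp n x) * g x) (\<lambda>x. fser c x * g x)
      (finite_subsets_at_top UNIV)"
  proof (rule bounded_bilinear.bounded_uniform_limit[OF bounded_bilinear_mult fser_uniform_limit[OF c] uniform_limit_const])
    show "bounded (fser c ` {a..b})" "bounded (g ` {a..b})"
      by (intro compact_imp_bounded compact_continuous_image continuous_on_fser c g compact_Icc)+
  qed
  obtain I J where I: "\<And>A. ((\<lambda>x. (\<Sum>n\<in>A. c n * fexp n x) * g x) has_integral I A) {a..b}"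
    and J: "((\<lambda>x. fser c x * g x) has_integral J) {a..b}"
    and IJ: "(I \<longlongrightarrow> J) (finite_subsets_at_top UNIV)"
    by (rule uniform_limit_integral[OF u]) (auto intro!: continuous_intros g)
  have "I A = (\<Sum>n\<in>A. c n * integral {a..b} (\<lambda>x. fexp n x * g x))" if "finite A" for A
  proof (rule has_integral_unique[OF I])
    have "((\<lambda>x. \<Sum>n\<in>A. c n * (fexp n x * g x)) has_integral
        (\<Sum>n\<in>A. c n * integral {a..b} (\<lambda>x. fexp n x * g x))) {a..b}"
      using that
      by (intro has_integral_sum has_integral_mult_right integrable_integral integrable_continuous_real
          continuous_intros g) auto
    then show "((\<lambda>x. (\<Sum>n\<in>A. c n * fexp n x) * g x) has_integral
        (\<Sum>n\<in>A. c n * integral {a..b} (\<lambda>x. fexp n x * g x))) {a..b}"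
      by (simp add: sum_distrib_right mult.assoc)
  qed
  then have "((\<lambda>A. \<Sum>n\<in>A. c n * integral {a..b} (\<lambda>x. fexp n x * g x)) \<longlongrightarrow> J) (finite_subsets_at_top UNIV)"
    using IJ by (subst tendsto_cong[where g = I]) (auto intro: eventually_finite_subsets_at_top_weakI)
  then show ?thesis using J by (simp add: has_sum_def integral_unique)
qed

lemma hat_fser:
  assumes c: "(\<lambda>n. norm (c n)) summable_on UNIV"
  shows "hat (fser c) n = of_real (2*pi) * c n"
proof -
  have "((\<lambda>m. c m * integral Ipi (\<lambda>x. fexp m x * fexp (- n) x)) has_sum hat (fser c) n) UNIV"
    unfolding hat_def by (rule fser_integral_has_sum[OF c]) (intro continuous_intros)
  then have "((\<lambda>m. c m * hat (fexp m) n) has_sum hat (fser c) n) UNIV"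
    unfolding hat_def[of "fexp _"] .
  moreover have "((\<lambda>m. c m * hat (fexp m) n) has_sum hat (fser c) n) UNIV
      \<longleftrightarrow> ((\<lambda>m. of_real (2*pi) * c n) has_sum hat (fser c) n) {n}"
    by (rule has_sum_cong_neutral) (auto simp: hat_fexp)
  moreover have "((\<lambda>m. of_real (2*pi) * c n) has_sum of_real (2*pi) * c n) {n}"
    by (rule has_sum_finiteI) auto
  ultimately show ?thesis using has_sum_unique by metis
qed

text \<open>The differentiated series is integrated term by term, which returns
  \<open>fser c\<close> up to its value at 0; its continuity then allows the fundamental theorem of
  calculus.\<close>

lemma fser_has_vector_derivative:
  assumes c: "(\<lambda>n. norm (c n)) summable_on UNIV" and d: "(\<lambda>n. norm (\<i> * of_int n * c n)) summable_on UNIV"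
    and x: "x \<in> Ipi"
  shows "(fser c has_vector_derivative fser (\<lambda>n. \<i> * of_int n * c n) x) (at x within Ipi)"
proof -
  let ?d = "\<lambda>n. \<i> * of_int n * c n"
  have eq: "fser c t = fser c 0 + integral {0..t} (fser ?d)" if t: "t \<in> Ipi" for t
  proof -
    have "((\<lambda>n. ?d n * integral {0..t} (\<lambda>x. fexp n x * 1)) has_sum integral {0..t} (\<lambda>x. fser ?d x * 1)) UNIV"
      by (rule fser_integral_has_sum[OF d]) (intro continuous_intros)
    moreover have "?d n * integral {0..t} (\<lambda>x. fexp n x * 1) = c n * fexp n t + - (c n * fexp n 0)" for n
    proof -
      have "((\<lambda>x. \<i> * of_int n * fexp n x) has_integral fexp n t - fexp n 0) {0..t}"
        using t by (intro fundamental_theorem_of_calculus fexp_has_vector_derivative) auto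
      then have "\<i> * of_int n * integral {0..t} (fexp n) = fexp n t - 1"
        by (simp add: integral_unique flip: integral_mult_right)
      then have "c n * (\<i> * of_int n * integral {0..t} (fexp n)) = c n * (fexp n t - 1)" by simp
      then show ?thesis by (simp add: algebra_simps)
    qed
    ultimately have "((\<lambda>n. c n * fexp n t + - (c n * fexp n 0)) has_sum integral {0..t} (fser ?d)) UNIV"
      by simp
    moreover have "((\<lambda>n. c n * fexp n t + - (c n * fexp n 0)) has_sum fser c t + - fser c 0) UNIV"
      by (intro has_sum_add has_sum_uminusI fser_has_sum c)
    ultimately have "integral {0..t} (fser ?d) = fser c t + - fser c 0"
      by (rule has_sum_unique)
    then show ?thesis by simp
  qed
  have "((\<lambda>t. fser c 0 + integral {0..t} (fser ?d)) has_vector_derivative fser ?d x) (at x within Ipi)"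
    using integral_has_vector_derivative[OF continuous_on_fser[OF d] x]
    by (auto intro!: derivative_eq_intros)
  then show ?thesis
    by (rule has_vector_derivative_transform[OF x, rotated]) (rule eq)
qed

text \<open>Integrating the series against the conjugate of its own sum turns the n-th term into
  \<open>c n * cnj (hat (fser c) n)\<close>, and \<open>hat_fser\<close> evaluates the second
  factor.\<close>

lemma parseval_fser:
  assumes c: "(\<lambda>n. norm (c n)) summable_on UNIV"
  shows "((\<lambda>n. 2*pi * (cmod (c n))\<^sup>2) has_sum integral Ipi (\<lambda>x. (cmod (fser c x))\<^sup>2)) UNIV"
proof -
  have "((\<lambda>n. c n * integral Ipi (\<lambda>x. fexp n x * cnj (fser c x))) has_sum
      integral Ipi (\<lambda>x. fser c x * cnj (fser c x))) UNIV"
    by (rule fser_integral_has_sum[OF c]) (intro continuous_intros continuous_on_fser c)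
  moreover have "integral Ipi (\<lambda>x. fexp n x * cnj (fser c x)) = cnj (hat (fser c) n)" for n
    unfolding hat_def Henstock_Kurzweil_Integration.integral_cnj by (simp add: mult.commute[of "fexp _ _"])
  moreover have "integral Ipi (\<lambda>x. fser c x * cnj (fser c x)) = of_real (integral Ipi (\<lambda>x. (cmod (fser c x))\<^sup>2))"
    unfolding complex_norm_square[symmetric] of_real_power[symmetric]
    by (intro integral_of_real_complex integrable_continuous_real continuous_intros continuous_on_fser c)
  moreover have "c n * cnj (hat (fser c) n) = complex_of_real (2*pi * (cmod (c n))\<^sup>2)" for n
    unfolding hat_fser[OF c] of_real_mult[of "2*pi"] complex_norm_square by simp
  ultimately have "((\<lambda>n. complex_of_real (2*pi * (cmod (c n))\<^sup>2)) has_sum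
      of_real (integral Ipi (\<lambda>x. (cmod (fser c x))\<^sup>2))) UNIV"
    by (simp only:)
  then show ?thesis by (simp only: has_sum_of_real_iff)
qed

lemma fser_real:
  assumes "\<And>n. c (- n) = cnj (c n)"
  shows "of_real (Re (fser c x)) = fser c x"
proof -
  have "cnj (fser c x) = (\<Sum>\<^sub>\<infinity>n. cnj (c n * fexp n x))"
    by (simp only: fser_def infsum_cnj)
  also have "\<dots> = (\<Sum>\<^sub>\<infinity>n. c (- n) * fexp (- n) x)"
    by (simp add: assms)
  also have "\<dots> = fser c x"
    unfolding fser_def
    by (rule infsum_reindex_bij_witness[of _ uminus uminus]) auto
  finally show ?thesis by (metis Reals_cnj_iff of_real_Re)
qed

lemma fser_diff:
  assumes "(\<lambda>n. norm (c n)) summable_on UNIV" "(\<lambda>n. norm (d n)) summable_on UNIV"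
  shows "fser (\<lambda>n. c n - d n) x = fser c x - fser d x"
proof -
  have "((\<lambda>n. c n * fexp n x + - (d n * fexp n x)) has_sum fser c x + - fser d x) UNIV"
    by (intro has_sum_add has_sum_uminusI fser_has_sum assms)
  then show ?thesis unfolding fser_def[of "\<lambda>n. c n - d n"]
    by (simp add: infsumI left_diff_distrib)
qed

lemma hat_cnj:
  "hat (\<lambda>x. of_real (f x)) (- n) = cnj (hat (\<lambda>x. of_real (f x)) n)"
  unfolding hat_def Henstock_Kurzweil_Integration.integral_cnj by simp

text \<open>Convolve the periodic extension of \<open>w\<close> with the reflection
  \<open>w (2*pi - y)\<close> and evaluate at 0: the integral is that of a square, while the series
  vanishes because all coefficients of \<open>w\<close> do.\<close>

lemma hat_zero_imp_zero:
  fixes w :: "real \<Rightarrow> real"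
  assumes w: "continuous_on Ipi w" "w 0 = w (2*pi)" and z: "\<And>n. hat (\<lambda>x. of_real (w x)) n = 0"
    and x: "x \<in> Ipi"
  shows "w x = 0"
proof -
  obtain H where H: "continuous_on (sphere 0 1) H" "\<And>t. t \<in> Ipi \<Longrightarrow> H (cis t) = w t"
    using periodic_factors_through_circle[OF w] by metis
  have c: "continuous_on Ipi (\<lambda>y. w (2*pi - y))"
    by (rule continuous_on_compose2[OF w(1)]) (auto intro!: continuous_intros)
  have hat0: "hat (\<lambda>t. of_real (H (cis t))) n = 0" for n
    using z[of n] H(2)
      integral_cong[of Ipi "\<lambda>t. of_real (H (cis t)) * fexp (- n) t" "\<lambda>t. of_real (w t) * fexp (- n) t"]
    by (simp add: hat_def)
  have "H (cis (0 - y)) * w (2*pi - y) = (w (2*pi - y))\<^sup>2" if "y \<in> Ipi" for y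
  proof -
    have "cis (0 - y) = cis (2*pi - y)" by (simp add: complex_eq_iff)
    then show ?thesis using H(2)[of "2*pi - y"] that by (simp add: power2_eq_square)
  qed
  then have "integral Ipi (\<lambda>y. H (cis (0 - y)) * w (2*pi - y)) = integral Ipi (\<lambda>y. (w (2*pi - y))\<^sup>2)"
    by (rule integral_cong)
  with convolution_expansion[OF H(1) L2_on_continuous[OF c], of 0]
  have "((\<lambda>n::int. 0) has_sum complex_of_real (2*pi * integral Ipi (\<lambda>y. (w (2*pi - y))\<^sup>2))) UNIV"
    by (simp add: hat0)
  then have "complex_of_real (2*pi * integral Ipi (\<lambda>y. (w (2*pi - y))\<^sup>2)) = 0"
    by (rule has_sum_unique[OF _ has_sum_0_simp])
  then have "integral Ipi (\<lambda>y. (w (2*pi - y))\<^sup>2) = 0" by simp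
  moreover have "continuous_on Ipi (\<lambda>y. (w (2*pi - y))\<^sup>2)" by (intro continuous_intros c)
  ultimately have "\<forall>y\<in>Ipi. (w (2*pi - y))\<^sup>2 = 0"
    by (subst (asm) integral_eq_0_iff) auto
  then show ?thesis using x by (auto dest!: bspec[where x = "2*pi - x"])
qed

section \<open>The solution operator of the linear equation\<close>

abbreviation rhat :: "(real \<Rightarrow> real) \<Rightarrow> int \<Rightarrow> complex" where
  "rhat f \<equiv> hat (\<lambda>x. complex_of_real (f x))"

text \<open>The eigenvalue of u |-> -u'' - b u' - a u on \<open>fexp n\<close>.\<close>

definition symb :: "real \<Rightarrow> real \<Rightarrow> int \<Rightarrow> complex" where
  "symb a b n = of_int (n\<^sup>2) - of_real a - \<i> * of_real b * of_int n"

lemma symb_uminus: "symb a b (- n) = cnj (symb a b n)"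
  by (simp add: symb_def)

text \<open>The inverse symbol decays like 1 / (1 + n^2), which pays for two derivatives of the
  solution. Only finitely many n escape a lower bound by the real part alone, and zeros of the
  symbol contribute 0 through \<open>cquot\<close>.\<close>

lemma symb_inverse_bound:
  obtains C where "C \<ge> 0" "\<And>n. (1 + (of_int n)\<^sup>2) * cmod (cquot 1 (symb a b n)) \<le> C"
proof -
  \<comment> \<open>If n^2 \<ge> |n| \<ge> 2|a| + 1, then n^2 - a \<ge> (1 + n^2) / 2, so the
    weighted inverse is at most 2; this is the 2 inserted into the maximum \<open>C\<close>.\<close>
  define m where "m = \<lceil>2 * \<bar>a\<bar> + 1\<rceil>"
  let ?h = "\<lambda>n. (1 + (real_of_int n)\<^sup>2) * cmod (cquot 1 (symb a b n))"
  define C where "C = Max (insert 2 (?h ` {-m..m}))"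
  have large: "?h n \<le> 2" if "n \<notin> {-m..m}" for n
  proof -
    have "real_of_int \<bar>n\<bar> \<ge> 2 * \<bar>a\<bar> + 1"
      using that unfolding m_def by (smt (verit) atLeastAtMost_iff ceiling_le_iff le_of_int_ceiling of_int_le_iff)
    moreover have "(real_of_int n)\<^sup>2 \<ge> real_of_int \<bar>n\<bar> * 1"
    proof -
      have "real_of_int \<bar>n\<bar> \<ge> 1" using calculation by linarith
      then have "real_of_int \<bar>n\<bar> * 1 \<le> real_of_int \<bar>n\<bar> * real_of_int \<bar>n\<bar>"
        by (intro mult_left_mono) auto
      then show ?thesis by (simp add: power2_eq_square abs_mult_self_eq)
    qed
    ultimately have "(real_of_int n)\<^sup>2 - a \<ge> (1 + (real_of_int n)\<^sup>2) / 2" by simp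
    moreover have "Re (symb a b n) = (real_of_int n)\<^sup>2 - a" by (simp add: symb_def)
    ultimately have "cmod (symb a b n) \<ge> (1 + (real_of_int n)\<^sup>2) / 2"
      using complex_Re_le_cmod[of "symb a b n"] by linarith
    moreover have "(1 + (real_of_int n)\<^sup>2) / 2 > 0"
      by (smt (verit) zero_le_power2 half_gt_zero)
    ultimately show ?thesis
      by (auto simp: cquot_def norm_divide divide_simps)
  qed
  have "?h n \<le> C" for n
  proof (cases "n \<in> {-m..m}")
    case True
    then show ?thesis unfolding C_def by (intro Max_ge) auto
  next
    case False
    have "2 \<le> C" unfolding C_def by (intro Max_ge) auto
    with large[OF False] show ?thesis by linarith
  qed
  moreover have "C \<ge> 0" unfolding C_def by (intro order_trans[OF _ Max_ge[of _ 2]]) auto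
  ultimately show ?thesis using that by blast
qed

text \<open>Division by \<open>2*pi\<close> because \<open>hat (fser c)\<close> is
  \<open>2*pi\<close> times \<open>c\<close>. At zeros of the symbol \<open>cquot\<close> selects
  the coefficient 0, that is, the solution satisfying the orthogonality conditions.\<close>

definition scoef :: "(real \<Rightarrow> real) \<Rightarrow> real \<Rightarrow> real \<Rightarrow> (real \<Rightarrow> real) \<Rightarrow> int \<Rightarrow> complex" where
  "scoef G a b f n = cquot (rhat G n) (symb a b n) * rhat f n / of_real (2*pi)"

definition sol :: "(real \<Rightarrow> real) \<Rightarrow> real \<Rightarrow> real \<Rightarrow> (real \<Rightarrow> real) \<Rightarrow> real \<Rightarrow> real" where
  "sol G a b f x = Re (fser (scoef G a b f) x)"

lemma scoef_uminus: "scoef G a b f (- n) = cnj (scoef G a b f n)"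
  by (simp add: scoef_def cquot_def symb_uminus hat_cnj)

lemma scoef_weighted_le:
  assumes "\<And>n. (1 + (of_int n)\<^sup>2) * cmod (cquot 1 (symb a b n)) \<le> C"
  shows "(1 + (of_int n)\<^sup>2) * norm (scoef G a b f n) \<le> C / (2*pi) * (norm (rhat G n) * norm (rhat f n))"
proof -
  have "(1 + (of_int n)\<^sup>2) * norm (scoef G a b f n)
      = ((1 + (of_int n)\<^sup>2) * cmod (cquot 1 (symb a b n))) * (norm (rhat G n) * norm (rhat f n) / (2*pi))"
    by (simp add: scoef_def cquot_def norm_mult norm_divide)
  also have "\<dots> \<le> C * (norm (rhat G n) * norm (rhat f n) / (2*pi))"
    by (intro mult_right_mono assms) auto
  finally show ?thesis by simp
qed

lemma scoef_weighted_summable: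
  assumes "L2_on G" "L2_on f"
  shows "(\<lambda>n. norm (complex_of_real (1 + (of_int n)\<^sup>2) * scoef G a b f n)) summable_on UNIV"
proof -
  obtain C where C: "\<And>n. (1 + (of_int n)\<^sup>2) * cmod (cquot 1 (symb a b n)) \<le> C"
    using symb_inverse_bound by metis
  show ?thesis
  proof (rule Infinite_Sum.abs_summable_on_comparison_test')
    show "(\<lambda>n. C / (2*pi) * (norm (rhat G n) * norm (rhat f n))) summable_on UNIV"
      by (intro summable_on_cmult_right bessel_product(1) assms)
    fix n :: int
    have "norm (complex_of_real (1 + (of_int n)\<^sup>2)) = 1 + (real_of_int n)\<^sup>2"
      unfolding norm_of_real by simp
    then show "norm (complex_of_real (1 + (of_int n)\<^sup>2) * scoef G a b f n)
        \<le> C / (2*pi) * (norm (rhat G n) * norm (rhat f n))"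
      using scoef_weighted_le[OF C, of n G f] by (simp only: norm_mult)
  qed
qed

text \<open>These are the series of u, u' and u'': the weight 1 + n^2 dominates 1, |n| and
  n^2.\<close>

lemma scoef_summable:
  assumes "L2_on G" "L2_on f"
  shows "(\<lambda>n. norm (scoef G a b f n)) summable_on UNIV"
    and "(\<lambda>n. norm (\<i> * of_int n * scoef G a b f n)) summable_on UNIV"
    and "(\<lambda>n. norm (\<i> * of_int n * (\<i> * of_int n * scoef G a b f n))) summable_on UNIV"
proof -
  have n: "norm (complex_of_real (1 + (of_int n)\<^sup>2)) = 1 + (real_of_int n)\<^sup>2" for n :: int
    unfolding norm_of_real by simp
  have le: "\<bar>real_of_int n\<bar> \<le> 1 + (real_of_int n)\<^sup>2" for n
    using zero_le_power2[of "\<bar>real_of_int n\<bar> - 1"] unfolding power2_diff by simp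
  have m: "c * norm (scoef G a b f n) \<le> (1 + (real_of_int n)\<^sup>2) * norm (scoef G a b f n)"
    if "c \<le> 1 + (real_of_int n)\<^sup>2" for c n
    using that by (rule mult_right_mono) simp
  have m3: "real_of_int n * real_of_int n * norm (scoef G a b f n)
      \<le> (1 + real_of_int n * real_of_int n) * norm (scoef G a b f n)" for n
    using m[of "(real_of_int n)\<^sup>2" n] by (simp add: power2_eq_square)
  note s = scoef_weighted_summable[OF assms, of a b]
  show "(\<lambda>n. norm (scoef G a b f n)) summable_on UNIV"
    by (rule Infinite_Sum.abs_summable_on_comparison_test'[OF s]) (use m[of 1] in \<open>simp add: norm_mult n del: of_real_add\<close>)
  show "(\<lambda>n. norm (\<i> * of_int n * scoef G a b f n)) summable_on UNIV"
    by (rule Infinite_Sum.abs_summable_on_comparison_test'[OF s]) (use m[OF le] in \<open>simp add: norm_mult n del: of_real_add\<close>)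
  show "(\<lambda>n. norm (\<i> * of_int n * (\<i> * of_int n * scoef G a b f n))) summable_on UNIV"
    by (rule Infinite_Sum.abs_summable_on_comparison_test'[OF s])
       (use m3 in \<open>simp add: norm_mult n power2_eq_square flip: mult.assoc del: of_real_add\<close>)
qed

lemma of_real_sol: "of_real (sol G a b f x) = fser (scoef G a b f) x"
  unfolding sol_def by (rule fser_real) (rule scoef_uminus)

lemma rhat_sol:
  assumes "L2_on G" "L2_on f"
  shows "rhat (sol G a b f) n = of_real (2*pi) * scoef G a b f n"
  unfolding of_real_sol by (rule hat_fser[OF scoef_summable(1)[OF assms]])

lemma continuous_on_sol:
  assumes "L2_on G" "L2_on f"
  shows "continuous_on S (sol G a b f)"
  unfolding sol_def by (intro continuous_intros continuous_on_fser scoef_summable assms)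

lemma L2_on_diff:
  assumes "L2_on f" "L2_on g"
  shows "L2_on (\<lambda>x. f x - g x)"
  unfolding L2_on_def
proof
  have abs: "f absolutely_integrable_on Ipi" "g absolutely_integrable_on Ipi"
    using assms by (auto simp: L2_on_def)
  show d: "(\<lambda>x. f x - g x) absolutely_integrable_on Ipi"
    using abs by (rule set_integral_diff)
  have "(\<lambda>x. (f x - g x)\<^sup>2) absolutely_integrable_on Ipi"
  proof (rule measurable_bounded_by_integrable_imp_absolutely_integrable)
    have "(\<lambda>x. f x - g x) \<in> borel_measurable (lebesgue_on Ipi)"
      using d by (simp add: absolutely_integrable_measurable)
    then show "(\<lambda>x. (f x - g x)\<^sup>2) \<in> borel_measurable (lebesgue_on Ipi)" by measurable
    show "(\<lambda>x. 2 * (f x)\<^sup>2 + 2 * (g x)\<^sup>2) integrable_on Ipi"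
      using assms by (auto simp: L2_on_def intro!: integrable_add integrable_on_mult_right)
    fix x
    show "norm ((f x - g x)\<^sup>2) \<le> 2 * (f x)\<^sup>2 + 2 * (g x)\<^sup>2"
      using zero_le_power2[of "f x + g x"] unfolding real_norm_def abs_power2 by (simp add: power2_sum power2_diff)
  qed auto
  then show "(\<lambda>x. (f x - g x)\<^sup>2) integrable_on Ipi"
    by (rule set_lebesgue_integral_eq_integral)
qed

lemma sol_diff:
  assumes G: "L2_on G" and "L2_on f" "L2_on g"
  shows "sol G a b f x - sol G a b g x = sol G a b (\<lambda>y. f y - g y) x"
proof -
  have "scoef G a b (\<lambda>y. f y - g y) = (\<lambda>n. scoef G a b f n - scoef G a b g n)"
    by (simp only: scoef_def[abs_def] hat_diff[OF assms(2,3)] right_diff_distrib diff_divide_distrib)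
  then show ?thesis
    unfolding sol_def by (simp add: fser_diff scoef_summable assms)
qed

text \<open>Parseval for the solution, Bessel for \<open>f\<close>. The factor \<open>2*pi\<close>
  is the one in Bessel's inequality; the \<open>2*pi\<close> of Parseval is absorbed by the
  denominator of \<open>scoef\<close> and the 1/sqrt(2 pi) inside
  \<open>fourier_coeff\<close>.\<close>

lemma integral_square_sol_le:
  assumes G: "L2_on G" and f: "L2_on f" and Q: "\<And>n. cmod (cquot (fourier_coeff G n) (symb a b n)) \<le> Q"
  shows "integral Ipi (\<lambda>x. (sol G a b f x)\<^sup>2) \<le> 2*pi * Q\<^sup>2 * integral Ipi (\<lambda>x. (f x)\<^sup>2)"
proof -
  have Q0: "Q \<ge> 0" using Q[of 0] norm_ge_zero order_trans by blast
  have eq: "(cmod (fser (scoef G a b f) x))\<^sup>2 = (sol G a b f x)\<^sup>2" for x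
    unfolding of_real_sol[symmetric] by simp
  have le: "2*pi * (cmod (scoef G a b f n))\<^sup>2 \<le> Q\<^sup>2 * (cmod (rhat f n))\<^sup>2" for n
  proof -
    have "sqrt (2*pi) * cmod (scoef G a b f n) = cmod (cquot (fourier_coeff G n) (symb a b n)) * cmod (rhat f n)"
    proof -
      have "2 * pi = sqrt (2*pi) * sqrt (2*pi)" by simp
      then have "sqrt (2*pi) / (2*pi) = 1 / sqrt (2*pi)"
        by (metis mult_eq_0_iff nonzero_divide_mult_cancel_left pi_neq_zero real_sqrt_eq_zero_cancel_iff zero_neq_numeral)
      then show ?thesis
        by (simp add: scoef_def cquot_def fourier_coeff_eq_hat norm_mult norm_divide field_simps)
    qed
    also have "\<dots> \<le> Q * cmod (rhat f n)" by (intro mult_right_mono Q) auto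
    finally have "(sqrt (2*pi) * cmod (scoef G a b f n))\<^sup>2 \<le> (Q * cmod (rhat f n))\<^sup>2"
      by (intro power_mono) auto
    then show ?thesis by (simp add: power_mult_distrib)
  qed
  have "((\<lambda>n. 2*pi * (cmod (scoef G a b f n))\<^sup>2) has_sum integral Ipi (\<lambda>x. (sol G a b f x)\<^sup>2)) UNIV"
    using parseval_fser[OF scoef_summable(1)[OF G f, of a b]] by (simp only: eq)
  moreover have "((\<lambda>n. Q\<^sup>2 * (cmod (rhat f n))\<^sup>2) has_sum Q\<^sup>2 * (\<Sum>\<^sub>\<infinity>n. (cmod (rhat f n))\<^sup>2)) UNIV"
    by (intro has_sum_cmult_right has_sum_infsum bessel f)
  ultimately have "integral Ipi (\<lambda>x. (sol G a b f x)\<^sup>2) \<le> Q\<^sup>2 * (\<Sum>\<^sub>\<infinity>n. (cmod (rhat f n))\<^sup>2)"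
    using le by (rule has_sum_mono)
  also have "\<dots> \<le> Q\<^sup>2 * (2*pi * integral Ipi (\<lambda>x. (f x)\<^sup>2))"
    by (intro mult_left_mono bessel f) auto
  finally show ?thesis by (simp add: mult_ac)
qed

text \<open>The smoothing property: the sum of |\<open>scoef\<close>| dominates the sup norm, and
  \<open>bessel_product\<close> bounds that sum by the L^2 norms of \<open>G\<close> and
  \<open>f\<close>. It matters that \<open>C\<close> depends on neither \<open>f\<close> nor
  \<open>x\<close>.\<close>

lemma sol_sup_bound:
  assumes G: "L2_on G"
  obtains C where "C \<ge> 0"
    "\<And>f x. L2_on f \<Longrightarrow> (sol G a b f x)\<^sup>2 \<le> C * integral Ipi (\<lambda>x. (f x)\<^sup>2)"
proof -
  obtain C where C: "C \<ge> 0" "\<And>n. (1 + (of_int n)\<^sup>2) * cmod (cquot 1 (symb a b n)) \<le> C"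
    using symb_inverse_bound by metis
  define D where "D = C * sqrt (integral Ipi (\<lambda>x. (G x)\<^sup>2))"
  have bd: "(sol G a b f x)\<^sup>2 \<le> D\<^sup>2 * integral Ipi (\<lambda>x. (f x)\<^sup>2)" if f: "L2_on f" for f x
  proof -
    have I0: "integral Ipi (\<lambda>x. (f x)\<^sup>2) \<ge> 0"
      using f by (auto simp: L2_on_def intro!: integral_nonneg)
    have "\<bar>sol G a b f x\<bar> \<le> norm (fser (scoef G a b f) x)"
      unfolding sol_def by (rule abs_Re_le_cmod)
    also have "\<dots> \<le> (\<Sum>\<^sub>\<infinity>n. norm (scoef G a b f n))"
      by (rule norm_fser_le[OF scoef_summable(1)[OF G f]])
    also have "\<dots> \<le> (\<Sum>\<^sub>\<infinity>n. C / (2*pi) * (norm (rhat G n) * norm (rhat f n)))"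
    proof (rule infsum_mono)
      fix n :: int
      have "1 * norm (scoef G a b f n) \<le> (1 + (of_int n)\<^sup>2) * norm (scoef G a b f n)"
        by (intro mult_right_mono) auto
      also note scoef_weighted_le[OF C(2)]
      finally show "norm (scoef G a b f n) \<le> C / (2*pi) * (norm (rhat G n) * norm (rhat f n))" by simp
    qed (intro scoef_summable summable_on_cmult_right bessel_product G f)+
    also have "\<dots> = C / (2*pi) * (\<Sum>\<^sub>\<infinity>n. norm (rhat G n) * norm (rhat f n))"
      by (rule infsum_cmult_right')
    also have "\<dots> \<le> C / (2*pi) * (2 * pi * sqrt (integral Ipi (\<lambda>x. (G x)\<^sup>2)) * sqrt (integral Ipi (\<lambda>x. (f x)\<^sup>2)))"
      using C by (intro mult_left_mono bessel_product G f) auto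
    also have "\<dots> = D * sqrt (integral Ipi (\<lambda>x. (f x)\<^sup>2))"
      by (simp add: D_def)
    finally have "\<bar>sol G a b f x\<bar>\<^sup>2 \<le> (D * sqrt (integral Ipi (\<lambda>x. (f x)\<^sup>2)))\<^sup>2"
      by (intro power_mono) auto
    then show ?thesis using I0 by (simp add: power_mult_distrib)
  qed
  show ?thesis by (rule that[of "D\<^sup>2"]) (use bd in auto)
qed

section \<open>Convolutions with periodic kernels and existence for the linear equation\<close>

lemma conv_eq_fser:
  assumes G: "continuous_on Ipi G" "G 0 = G (2*pi)" and f: "L2_on f"
  shows "complex_of_real (integral Ipi (\<lambda>y. per_ext G (x - y) * f y))
      = fser (\<lambda>n. rhat G n * rhat f n / of_real (2*pi)) x"
proof -
  obtain H where H: "continuous_on (sphere 0 1) H" "\<And>t. t \<in> Ipi \<Longrightarrow> H (cis t) = G t"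
    "\<And>t. per_ext G t = H (cis t)"
    using periodic_factors_through_circle[OF G] by metis
  have "hat (\<lambda>t. of_real (H (cis t))) n = rhat G n" for n
    unfolding hat_def by (intro integral_cong) (simp add: H(2))
  then have "((\<lambda>n. rhat G n * rhat f n * fexp n x) has_sum
      of_real (2*pi * integral Ipi (\<lambda>y. per_ext G (x - y) * f y))) UNIV"
    using convolution_expansion[OF H(1) f, of x] by (simp add: H(3))
  from has_sum_cmult_right[OF this, of "1 / of_real (2*pi)"]
  have "((\<lambda>n. rhat G n * rhat f n / of_real (2*pi) * fexp n x) has_sum
      of_real (integral Ipi (\<lambda>y. per_ext G (x - y) * f y))) UNIV"
    by (simp add: field_simps)
  then show ?thesis unfolding fser_def by (simp add: infsumI)
qed

lemma conv_coeff_summable: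
  assumes "L2_on G" "L2_on f"
  shows "(\<lambda>n. norm (rhat G n * rhat f n / of_real (2*pi))) summable_on UNIV"
proof -
  have "(\<lambda>n. 1 / (2*pi) * (norm (rhat G n) * norm (rhat f n))) summable_on UNIV"
    by (intro summable_on_cmult_right bessel_product assms)
  then show ?thesis by (simp add: norm_mult norm_divide)
qed

lemma conv_continuous:
  assumes G: "continuous_on Ipi G" "G 0 = G (2*pi)" and f: "L2_on f"
  shows "continuous_on S (\<lambda>x. integral Ipi (\<lambda>y. per_ext G (x - y) * f y))"
    and "rhat (\<lambda>x. integral Ipi (\<lambda>y. per_ext G (x - y) * f y)) n = rhat G n * rhat f n"
proof -
  note s = conv_coeff_summable[OF L2_on_continuous[OF G(1)] f]
  have "integral Ipi (\<lambda>y. per_ext G (x - y) * f y) = Re (fser (\<lambda>n. rhat G n * rhat f n / of_real (2*pi)) x)" for x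
    unfolding conv_eq_fser[OF assms, symmetric] by simp
  moreover have "continuous_on S (\<lambda>x. Re (fser (\<lambda>n. rhat G n * rhat f n / of_real (2*pi)) x))"
    by (intro continuous_intros continuous_on_fser s)
  ultimately show "continuous_on S (\<lambda>x. integral Ipi (\<lambda>y. per_ext G (x - y) * f y))"
    by simp
  show "rhat (\<lambda>x. integral Ipi (\<lambda>y. per_ext G (x - y) * f y)) n = rhat G n * rhat f n"
    unfolding conv_eq_fser[OF assms] hat_fser[OF s] by simp
qed

text \<open>The derivatives are the real parts of the series differentiated once and twice. The
  equation then holds at every point, since its two sides have the same absolutely convergent
  expansion.\<close>

lemma sol_solves:
  assumes G: "continuous_on Ipi G" "G 0 = G (2*pi)" and f: "L2_on f"
    and sol: "\<And>n. symb a b n = 0 \<Longrightarrow> rhat G n = 0"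
  obtains u1 u2 where "H2_with (sol G a b f) u1 u2"
    "\<And>x. - u2 x - b * u1 x - a * sol G a b f x = integral Ipi (\<lambda>y. per_ext G (x - y) * f y)"
proof -
  note L2G = L2_on_continuous[OF G(1)]
  define c where "c = scoef G a b f"
  define c1 where "c1 n = \<i> * of_int n * c n" for n
  define c2 where "c2 n = \<i> * of_int n * c1 n" for n
  note s = scoef_summable[OF L2G f, of a b, folded c_def, folded c1_def, folded c2_def]
  define u1 where "u1 x = Re (fser c1 x)" for x
  define u2 where "u2 x = Re (fser c2 x)" for x
  have u: "sol G a b f = (\<lambda>x. Re (fser c x))" by (simp add: sol_def[abs_def] c_def)
  have d0: "(sol G a b f has_real_derivative u1 x) (at x within Ipi)" if "x \<in> Ipi" for x
    using fser_has_vector_derivative[OF s(1) s(2)[unfolded c1_def] that]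
    unfolding u u1_def c1_def has_vector_derivative_complex_iff by simp
  have d1: "(u1 has_real_derivative u2 x) (at x within Ipi)" if "x \<in> Ipi" for x
    using fser_has_vector_derivative[OF s(2) s(3)[unfolded c2_def] that]
    unfolding u2_def u1_def[abs_def] c2_def has_vector_derivative_complex_iff by simp
  have fser_2pi: "fser d (2*pi) = fser d 0" for d by (simp add: fser_def)
  have ftc: "u1 x = u1 0 + integral {0..x} u2" if "x \<in> Ipi" for x
  proof -
    have "(u2 has_integral u1 x - u1 0) {0..x}"
      using that
      by (intro fundamental_theorem_of_calculus)
         (auto simp: has_real_derivative_iff_has_vector_derivative[symmetric] intro!: DERIV_subset[OF d1])
    then show ?thesis by (simp add: integral_unique)
  qed
  have "continuous_on Ipi u2"
    unfolding u2_def by (intro continuous_intros continuous_on_fser s)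
  then have "H2_with (sol G a b f) u1 u2"
    unfolding H2_with_def
    by (intro conjI ballI L2_on_continuous d0 ftc) (auto simp: u u1_def fser_2pi)
  moreover have "- u2 x - b * u1 x - a * sol G a b f x = integral Ipi (\<lambda>y. per_ext G (x - y) * f y)" for x
  proof -
    have "((\<lambda>n. - (c2 n * fexp n x) + (- of_real b) * (c1 n * fexp n x) + (- of_real a) * (c n * fexp n x)) has_sum
        - fser c2 x + (- of_real b) * fser c1 x + (- of_real a) * fser c x) UNIV"
      by (intro has_sum_add has_sum_uminusI has_sum_cmult_right fser_has_sum s)
    moreover have "- (c2 n * fexp n x) + (- of_real b) * (c1 n * fexp n x) + (- of_real a) * (c n * fexp n x)
        = rhat G n * rhat f n / of_real (2*pi) * fexp n x" for n
    proof -
      have "- (c2 n * fexp n x) + (- of_real b) * (c1 n * fexp n x) + (- of_real a) * (c n * fexp n x)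
          = symb a b n * c n * fexp n x"
        by (simp add: c2_def c1_def symb_def power2_eq_square algebra_simps)
      \<comment> \<open>At a zero of the symbol the left side is 0, and solvability is precisely
        that the right side is 0 as well: there \<open>rhat G n\<close> vanishes by
        \<open>sol\<close>.\<close>
      also have "symb a b n * c n = rhat G n * rhat f n / of_real (2*pi)"
        using sol[of n] by (auto simp: c_def scoef_def cquot_def)
      finally show ?thesis .
    qed
    ultimately have "- fser c2 x + (- of_real b) * fser c1 x + (- of_real a) * fser c x
        = fser (\<lambda>n. rhat G n * rhat f n / of_real (2*pi)) x"
      by (simp add: fser_def infsumI)
    also have "\<dots> = of_real (integral Ipi (\<lambda>y. per_ext G (x - y) * f y))"
      by (rule conv_eq_fser[OF G f, symmetric])
    finally have "Re (- fser c2 x + (- of_real b) * fser c1 x + (- of_real a) * fser c x)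
        = integral Ipi (\<lambda>y. per_ext G (x - y) * f y)" by simp
    then show ?thesis by (simp add: u u1_def u2_def)
  qed
  ultimately show ?thesis using that by blast
qed

section \<open>Uniqueness for the linear equation\<close>

lemma rhat_deriv:
  assumes d: "\<And>x. x \<in> Ipi \<Longrightarrow> (v has_real_derivative v' x) (at x within Ipi)"
    and c: "continuous_on Ipi v'" and p: "v 0 = v (2*pi)"
  shows "rhat v' n = \<i> * of_int n * rhat v n"
proof -
  have cv: "continuous_on Ipi v" using d by (rule DERIV_continuous_on)
  have dW: "((\<lambda>x. of_real (v x) * fexp (- n) x) has_vector_derivative
      of_real (v x) * (\<i> * of_int (- n) * fexp (- n) x) + of_real (v' x) * fexp (- n) x) (at x within Ipi)"
    if "x \<in> Ipi" for x
    using d[OF that]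
    by (intro has_vector_derivative_mult fexp_has_vector_derivative has_vector_derivative_of_real)
  \<comment> \<open>Integration by parts; the boundary terms will cancel because both
    \<open>v\<close> and \<open>fexp (- n)\<close> take equal values at 0 and
    \<open>2*pi\<close>.\<close>
  have A: "((\<lambda>x. of_real (v x) * (\<i> * of_int (- n) * fexp (- n) x) + of_real (v' x) * fexp (- n) x) has_integral
      of_real (v (2*pi)) * fexp (- n) (2*pi) - of_real (v 0) * fexp (- n) 0) Ipi"
    by (intro fundamental_theorem_of_calculus dW) auto
  have B: "((\<lambda>x. (\<i> * of_int (- n)) * (of_real (v x) * fexp (- n) x) + of_real (v' x) * fexp (- n) x) has_integral
      (\<i> * of_int (- n)) * rhat v n + rhat v' n) Ipi"
    by (intro has_integral_add has_integral_mult_right hat_has_integral L2_on_continuous c cv)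
  have eq: "(\<lambda>x. (\<i> * of_int (- n)) * (of_real (v x) * fexp (- n) x) + of_real (v' x) * fexp (- n) x)
      = (\<lambda>x. of_real (v x) * (\<i> * of_int (- n) * fexp (- n) x) + of_real (v' x) * fexp (- n) x)"
    by (simp only: mult_ac)
  have "(\<i> * of_int (- n)) * rhat v n + rhat v' n
      = of_real (v (2*pi)) * fexp (- n) (2*pi) - of_real (v 0) * fexp (- n) 0"
    by (rule has_integral_unique[OF B[unfolded eq] A])
  then have "- (\<i> * of_int n * rhat v n) + rhat v' n = 0" using p by simp
  then show ?thesis by (simp add: add_eq_0_iff)
qed

lemma H2_with_continuous: "H2_with v v1 v2 \<Longrightarrow> continuous_on Ipi v"
  unfolding H2_with_def by (blast intro: DERIV_continuous_on)

text \<open>The equation exhibits the second derivative as an a.e. modification of a continuous function.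
  Hence the solution is classically twice differentiable, and integrating by parts needs no theory of
  absolutely continuous functions.\<close>

lemma H2_with_equation_rhat:
  assumes w: "H2_with w w1 w2" and Z: "Z \<in> null_sets lebesgue"
    and eq: "\<And>x. x \<in> Ipi - Z \<Longrightarrow> - w2 x - b * w1 x - a * w x = g x"
    and g: "continuous_on Ipi g"
  shows "symb a b n * rhat w n = rhat g n"
proof -
  have cw: "continuous_on Ipi w" using w by (rule H2_with_continuous)
  have w': "\<And>x. x \<in> Ipi \<Longrightarrow> (w has_real_derivative w1 x) (at x within Ipi)"
    "\<And>x. x \<in> Ipi \<Longrightarrow> w1 x = w1 0 + integral {0..x} w2"
    "w 0 = w (2*pi)" "w1 0 = w1 (2*pi)"
    using w unfolding H2_with_def by blast+
  have w2: "w2 integrable_on Ipi"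
    using w unfolding H2_with_def L2_on_def by (blast intro: set_lebesgue_integral_eq_integral)
  have "continuous_on Ipi (\<lambda>x. w1 0 + integral {0..x} w2)"
    by (intro continuous_intros indefinite_integral_continuous_1 w2)
  then have cw1: "continuous_on Ipi w1"
    by (rule continuous_on_eq) (rule w'(2)[symmetric])
  \<comment> \<open>The equation solved for the second derivative, hence a continuous function equal
    to \<open>w2\<close> off \<open>Z\<close>; integrals do not distinguish the two.\<close>
  define v2 where "v2 x = - g x - b * w1 x - a * w x" for x
  have cv2: "continuous_on Ipi v2"
    unfolding v2_def by (intro continuous_intros g cw cw1)
  have w1: "w1 x = w1 0 + integral {0..x} v2" if "x \<in> Ipi" for x
  proof -
    have "integral {0..x} w2 = integral {0..x} v2"
    proof (rule integral_spike)
      show "negligible Z" using Z by (simp add: negligible_iff_null_sets)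
      fix y assume "y \<in> {0..x} - Z"
      then show "v2 y = w2 y" using eq[of y] that by (auto simp: v2_def algebra_simps)
    qed
    with w'(2)[OF that] show ?thesis by metis
  qed
  have d1: "(w1 has_real_derivative v2 x) (at x within Ipi)" if "x \<in> Ipi" for x
  proof -
    have "((\<lambda>t. w1 0 + integral {0..t} v2) has_vector_derivative v2 x) (at x within Ipi)"
      using integral_has_vector_derivative[OF cv2 that]
      by (auto intro!: derivative_eq_intros)
    then have "(w1 has_vector_derivative v2 x) (at x within Ipi)"
      by (rule has_vector_derivative_transform[OF that, rotated]) (rule w1)
    then show ?thesis by (simp add: has_real_derivative_iff_has_vector_derivative)
  qed
  have h1: "rhat w1 n = \<i> * of_int n * rhat w n"
    by (rule rhat_deriv[OF w'(1) cw1 w'(3)])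
  have h2: "rhat v2 n = \<i> * of_int n * rhat w1 n"
    by (rule rhat_deriv[OF d1 cv2 w'(4)])
  have "((\<lambda>x. - (of_real (v2 x) * fexp (- n) x) + (- of_real b) * (of_real (w1 x) * fexp (- n) x)
        + (- of_real a) * (of_real (w x) * fexp (- n) x)) has_integral
      - rhat v2 n + (- of_real b) * rhat w1 n + (- of_real a) * rhat w n) Ipi"
    by (intro has_integral_add has_integral_neg has_integral_mult_right hat_has_integral L2_on_continuous
        cw cw1 cv2)
  moreover have "(\<lambda>x. - (of_real (v2 x) * fexp (- n) x) + (- of_real b) * (of_real (w1 x) * fexp (- n) x)
        + (- of_real a) * (of_real (w x) * fexp (- n) x)) = (\<lambda>x. of_real (g x) * fexp (- n) x)"
    by (simp add: v2_def algebra_simps)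
  ultimately have "rhat g n = - rhat v2 n + (- of_real b) * rhat w1 n + (- of_real a) * rhat w n"
    unfolding hat_def[of "\<lambda>x. complex_of_real (g x)"] by (simp add: integral_unique)
  then show ?thesis unfolding h2 h1 by (simp add: symb_def power2_eq_square algebra_simps)
qed

lemma eq_of_rhat_eq:
  assumes "continuous_on Ipi v" "continuous_on Ipi w" "v 0 = v (2*pi)" "w 0 = w (2*pi)"
    and "\<And>n. rhat v n = rhat w n" and "x \<in> Ipi"
  shows "v x = w x"
proof -
  have "v x - w x = 0"
  proof (rule hat_zero_imp_zero[where w = "\<lambda>x. v x - w x"])
    show "rhat (\<lambda>x. v x - w x) n = 0" for n
      using assms by (simp add: hat_diff L2_on_continuous del: of_real_diff)
  qed (use assms in \<open>auto intro!: continuous_intros\<close>)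
  then show ?thesis by simp
qed

section \<open>Superposition operators\<close>

lemma enorm_nonneg [simp]: "enorm N u \<ge> 0"
  by (simp add: enorm_def sum_nonneg)

lemma enorm_square: "(enorm N u)\<^sup>2 = (\<Sum>k=1..N. (u k)\<^sup>2)"
  by (simp add: enorm_def sum_nonneg)

text \<open>Freezing \<open>v\<close> at grid points leaves countably many vectors, for each of
  which \<open>f\<close> is measurable in \<open>x\<close>; the Lipschitz bound makes these
  approximations converge pointwise as the grid is refined.\<close>

lemma nemytskii_measurable:
  assumes meas: "\<And>u. f u \<in> borel_measurable (lebesgue_on Ipi)"
    and lip: "\<And>u1 u2 x. x \<in> Ipi \<Longrightarrow> \<bar>f u1 x - f u2 x\<bar> \<le> L * enorm N (\<lambda>j. u1 j - u2 j)"
    and v: "\<And>j. j \<in> {1..N} \<Longrightarrow> continuous_on Ipi (v j)"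
  shows "(\<lambda>y. f (\<lambda>j. v j y) y) \<in> borel_measurable (lebesgue_on Ipi)"
proof (rule borel_measurable_LIMSEQ_metric)
  \<comment> \<open>Rounding down keeps the sample point in the interval: 0 lies on every grid, and
    t never exceeds y.\<close>
  define t where "t m y = real_of_int \<lfloor>y * real (Suc m)\<rfloor> / real (Suc m)" for m y
  define g where "g m y = f (\<lambda>j. v j (t m y)) y" for m y
  show "g m \<in> borel_measurable (lebesgue_on Ipi)" for m
  proof -
    have "(\<lambda>y. \<lfloor>y * real (Suc m)\<rfloor>) \<in> measurable (lebesgue_on Ipi) (count_space UNIV)"
    proof -
      have "(\<lambda>y. y * real (Suc m)) \<in> borel_measurable (lebesgue_on Ipi)"
        by (intro continuous_imp_measurable_on_sets_lebesgue continuous_intros) auto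
      then show ?thesis by (rule measurable_compose[OF _ measurable_real_floor])
    qed
    from measurable_compose_countable[where f = "\<lambda>i. f (\<lambda>j. v j (real_of_int i / real (Suc m)))", OF meas this]
    show ?thesis by (simp add: g_def[abs_def] t_def)
  qed
  fix y assume "y \<in> space (lebesgue_on Ipi)"
  then have y: "y \<in> Ipi" by simp
  have bounds: "t m y \<le> y" "y - 1 / real (Suc m) \<le> t m y" "0 \<le> t m y" for m
  proof -
    have "real_of_int \<lfloor>y * real (Suc m)\<rfloor> \<le> y * real (Suc m)"
      "y * real (Suc m) - 1 \<le> real_of_int \<lfloor>y * real (Suc m)\<rfloor>" by linarith+
    then have "t m y \<le> (y * real (Suc m)) / real (Suc m)" "(y * real (Suc m) - 1) / real (Suc m) \<le> t m y"
      unfolding t_def by (intro divide_right_mono; simp)+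
    then show "t m y \<le> y" "y - 1 / real (Suc m) \<le> t m y"
      by (simp_all add: diff_divide_distrib del: of_nat_Suc)
    show "0 \<le> t m y" using y unfolding t_def by simp
  qed
  have "(\<lambda>m. t m y) \<longlonglongrightarrow> y"
  proof (rule tendsto_sandwich)
    show "(\<lambda>m. y - 1 / real (Suc m)) \<longlonglongrightarrow> y"
      using tendsto_diff[OF tendsto_const LIMSEQ_inverse_real_of_nat, of y] by (simp add: inverse_eq_divide)
    show "(\<lambda>m. y) \<longlonglongrightarrow> y" by simp
  qed (use bounds in auto)
  then have "(\<lambda>m. v j (t m y)) \<longlonglongrightarrow> v j y" if "j \<in> {1..N}" for j
    by (rule continuous_on_tendsto_compose[OF v[OF that]]) (use y bounds in \<open>auto intro!: always_eventually intro: order_trans[OF bounds(1)]\<close>)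
  then have "(\<lambda>m. enorm N (\<lambda>j. v j (t m y) - v j y)) \<longlonglongrightarrow> enorm N (\<lambda>j. v j y - v j y)"
    unfolding enorm_def by (intro tendsto_intros) auto
  then have "(\<lambda>m. L * enorm N (\<lambda>j. v j (t m y) - v j y)) \<longlonglongrightarrow> L * 0"
    by (intro tendsto_intros) (simp add: enorm_def)
  then have "(\<lambda>m. L * enorm N (\<lambda>j. v j (t m y) - v j y)) \<longlonglongrightarrow> 0" by simp
  then show "(\<lambda>m. g m y) \<longlonglongrightarrow> f (\<lambda>j. v j y) y"
  proof (rule LIM_zero_cancel[OF Lim_null_comparison[rotated]])
    have "norm (g m y - f (\<lambda>j. v j y) y) \<le> L * enorm N (\<lambda>j. v j (t m y) - v j y)" for m
      unfolding g_def real_norm_def by (rule lip[OF y])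
    then show "\<forall>\<^sub>F m in sequentially. norm (g m y - f (\<lambda>j. v j y) y) \<le> L * enorm N (\<lambda>j. v j (t m y) - v j y)"
      by simp
  qed
qed

lemma continuous_on_enorm:
  assumes "\<And>j. j \<in> {1..N} \<Longrightarrow> continuous_on S (v j)"
  shows "continuous_on S (\<lambda>y. enorm N (\<lambda>j. v j y))"
  unfolding enorm_def by (intro continuous_intros assms)

text \<open>\<open>v\<close> is continuous, so the growth condition dominates the composite by a
  continuous function plus \<open>h\<close>, and its square by twice the sum of the two
  squares.\<close>

lemma nemytskii_L2:
  assumes meas: "\<And>u. f u \<in> borel_measurable (lebesgue_on Ipi)"
    and lip: "\<And>u1 u2 x. x \<in> Ipi \<Longrightarrow> \<bar>f u1 x - f u2 x\<bar> \<le> L * enorm N (\<lambda>j. u1 j - u2 j)"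
    and growth: "\<And>u x. x \<in> Ipi \<Longrightarrow> \<bar>f u x\<bar> \<le> K * enorm N u + h x"
    and h: "L2_on h"
    and v: "\<And>j. j \<in> {1..N} \<Longrightarrow> continuous_on Ipi (v j)"
  shows "L2_on (\<lambda>y. f (\<lambda>j. v j y) y)"
proof -
  let ?f = "\<lambda>y. f (\<lambda>j. v j y) y" and ?e = "\<lambda>y. K * enorm N (\<lambda>j. v j y)"
  have m: "?f \<in> borel_measurable (lebesgue_on Ipi)"
    using meas lip v by (rule nemytskii_measurable)
  have e: "continuous_on Ipi ?e" by (intro continuous_intros continuous_on_enorm v)
  have hi: "h integrable_on Ipi" "(\<lambda>x. (h x)\<^sup>2) integrable_on Ipi"
    using h by (auto simp: L2_on_def intro: set_lebesgue_integral_eq_integral)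
  have "?f absolutely_integrable_on Ipi"
  proof (rule measurable_bounded_by_integrable_imp_absolutely_integrable[OF m])
    show "(\<lambda>y. ?e y + h y) integrable_on Ipi"
      by (intro integrable_add integrable_continuous_real e hi)
  qed (use growth in auto)
  moreover have "(\<lambda>y. (?f y)\<^sup>2) absolutely_integrable_on Ipi"
  proof (rule measurable_bounded_by_integrable_imp_absolutely_integrable)
    show "(\<lambda>y. (?f y)\<^sup>2) \<in> borel_measurable (lebesgue_on Ipi)" using m by measurable
    show "(\<lambda>y. 2 * (?e y)\<^sup>2 + 2 * (h y)\<^sup>2) integrable_on Ipi"
      by (intro integrable_add integrable_on_mult_right integrable_continuous_real continuous_intros e hi)
    fix y assume "y \<in> Ipi"
    then have "\<bar>?f y\<bar>\<^sup>2 \<le> (?e y + h y)\<^sup>2" by (intro power_mono growth) auto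
    also have "\<dots> \<le> 2 * (?e y)\<^sup>2 + 2 * (h y)\<^sup>2"
      using zero_le_power2[of "?e y - h y"] by (simp add: power2_sum power2_diff)
    finally show "norm ((?f y)\<^sup>2) \<le> 2 * (?e y)\<^sup>2 + 2 * (h y)\<^sup>2" by simp
  qed auto
  ultimately show ?thesis
    by (auto simp: L2_on_def intro: set_lebesgue_integral_eq_integral)
qed

section \<open>Fixed points of smoothing contractions\<close>

definition cont_vec :: "nat \<Rightarrow> (nat \<Rightarrow> real \<Rightarrow> real) \<Rightarrow> bool" where
  "cont_vec N v \<longleftrightarrow> (\<forall>k\<in>{1..N}. continuous_on Ipi (v k))"

definition sqdist :: "nat \<Rightarrow> (nat \<Rightarrow> real \<Rightarrow> real) \<Rightarrow> (nat \<Rightarrow> real \<Rightarrow> real) \<Rightarrow> real" where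
  "sqdist N u v = (\<Sum>k=1..N. integral Ipi (\<lambda>x. (u k x - v k x)\<^sup>2))"

lemma sqdist_nonneg [simp]: "sqdist N u v \<ge> 0"
proof -
  have "integral Ipi (\<lambda>x. (u k x - v k x)\<^sup>2) \<ge> 0" for k
    by (cases "(\<lambda>x. (u k x - v k x)\<^sup>2) integrable_on Ipi")
       (auto intro: integral_nonneg simp: not_integrable_integral)
  then show ?thesis unfolding sqdist_def by (intro sum_nonneg)
qed

text \<open>The map contracts the \<open>L\<^sup>2\<close> distance only, and continuous functions are not complete for it;
  the smoothing bound upgrades \<open>L\<^sup>2\<close> convergence of the iterates to uniform convergence.\<close>

lemma smoothing_contraction_fixed_point:
  fixes T :: "(nat \<Rightarrow> real \<Rightarrow> real) \<Rightarrow> nat \<Rightarrow> real \<Rightarrow> real"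
  assumes Tc: "\<And>v. cont_vec N v \<Longrightarrow> cont_vec N (T v)"
    and contr: "\<And>u v. cont_vec N u \<Longrightarrow> cont_vec N v \<Longrightarrow> sqdist N (T u) (T v) \<le> \<theta> * sqdist N u v"
    and \<theta>: "0 \<le> \<theta>" "\<theta> < 1"
    and smooth: "\<And>u v k x. cont_vec N u \<Longrightarrow> cont_vec N v \<Longrightarrow> k \<in> {1..N} \<Longrightarrow> x \<in> Ipi \<Longrightarrow>
      (T u k x - T v k x)\<^sup>2 \<le> C * sqdist N u v"
  obtains w where "cont_vec N w" "eq_on_I N w (T w)"
proof -
  define vs where "vs m = (T ^^ m) (\<lambda>_ _. 0)" for m
  have vs_Suc: "vs (Suc m) = T (vs m)" for m by (simp add: vs_def)
  have vsc: "cont_vec N (vs m)" for m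
  proof (induction m)
    case 0
    then show ?case by (auto simp: vs_def cont_vec_def)
  next
    case (Suc m)
    then show ?case unfolding vs_Suc by (rule Tc)
  qed
  define d where "d = sqdist N (vs 1) (vs 0)"
  have geo: "sqdist N (vs (Suc m)) (vs m) \<le> \<theta> ^ m * d" for m
  proof (induction m)
    case 0
    then show ?case by (simp add: d_def)
  next
    case (Suc m)
    have "sqdist N (vs (Suc (Suc m))) (vs (Suc m)) \<le> \<theta> * sqdist N (vs (Suc m)) (vs m)"
      unfolding vs_Suc[of "Suc m"] vs_Suc[of m] by (intro contr vsc Tc)
    also have "\<dots> \<le> \<theta> * (\<theta> ^ m * d)" by (intro mult_left_mono Suc \<theta>)
    finally show ?case by (simp add: mult.assoc)
  qed
  \<comment> \<open>The sign of \<open>C\<close> is not given, whereas the monotonicity steps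
    multiply by it.\<close>
  define C' where "C' = max C 0"
  have smooth': "(T u k x - T v k x)\<^sup>2 \<le> C' * sqdist N u v"
    if "cont_vec N u" "cont_vec N v" "k \<in> {1..N}" "x \<in> Ipi" for u v k x
  proof -
    have "(T u k x - T v k x)\<^sup>2 \<le> C * sqdist N u v" by (rule smooth[OF that])
    also have "\<dots> \<le> C' * sqdist N u v" unfolding C'_def by (intro mult_right_mono) auto
    finally show ?thesis .
  qed
  have step: "\<bar>vs (Suc (Suc m)) k x - vs (Suc m) k x\<bar> \<le> sqrt (C' * d) * sqrt \<theta> ^ m"
    if "k \<in> {1..N}" "x \<in> Ipi" for k x m
  proof -
    have "(vs (Suc (Suc m)) k x - vs (Suc m) k x)\<^sup>2 \<le> C' * sqdist N (vs (Suc m)) (vs m)"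
      unfolding vs_Suc[of "Suc m"] vs_Suc[of m] by (intro smooth' vsc Tc that)
    also have "\<dots> \<le> C' * (\<theta> ^ m * d)" by (intro mult_left_mono geo) (simp add: C'_def)
    finally have "sqrt ((vs (Suc (Suc m)) k x - vs (Suc m) k x)\<^sup>2) \<le> sqrt (C' * (\<theta> ^ m * d))"
      by (rule real_sqrt_le_mono)
    then have "\<bar>vs (Suc (Suc m)) k x - vs (Suc m) k x\<bar> \<le> sqrt (C' * (\<theta> ^ m * d))"
      by (simp only: real_sqrt_abs)
    then show ?thesis by (simp add: real_sqrt_mult real_sqrt_power mult_ac)
  qed
  have summ: "summable (\<lambda>m. sqrt (C' * d) * sqrt \<theta> ^ m)"
    using \<theta> by (intro summable_mult summable_geometric) simp
  \<comment> \<open>The telescoping series starts at \<open>vs 1\<close>, not \<open>vs 0\<close>: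
    smoothing bounds differences of images under \<open>T\<close>, so the increment from m + 1 to m
    + 2 is paid for by the distance of the iterates m and m + 1. The ratio is
    \<open>sqrt \<theta>\<close> since \<open>\<theta>\<close> contracts squared distances.\<close>
  define w where "w k x = vs 1 k x + (\<Sum>m. vs (Suc (Suc m)) k x - vs (Suc m) k x)" for k x
  have ul: "uniform_limit Ipi (\<lambda>n. vs (Suc n) k) (w k) sequentially" if k: "k \<in> {1..N}" for k
  proof -
    have "uniform_limit Ipi (\<lambda>n x. \<Sum>m<n. vs (Suc (Suc m)) k x - vs (Suc m) k x)
        (\<lambda>x. \<Sum>m. vs (Suc (Suc m)) k x - vs (Suc m) k x) sequentially"
      using step[OF k] by (intro Weierstrass_m_test[OF _ summ]) auto
    then have "uniform_limit Ipi (\<lambda>n x. vs 1 k x + (\<Sum>m<n. vs (Suc (Suc m)) k x - vs (Suc m) k x))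
        (\<lambda>x. vs 1 k x + (\<Sum>m. vs (Suc (Suc m)) k x - vs (Suc m) k x)) sequentially"
      by (intro uniform_limit_intros)
    moreover have "vs 1 k x + (\<Sum>m<n. vs (Suc (Suc m)) k x - vs (Suc m) k x) = vs (Suc n) k x" for n x
      using sum_lessThan_telescope[of "\<lambda>m. vs (Suc m) k x" n] by simp
    ultimately show ?thesis by (simp add: w_def[abs_def])
  qed
  have wc: "cont_vec N w"
    unfolding cont_vec_def
  proof
    fix k assume k: "k \<in> {1..N}"
    show "continuous_on Ipi (w k)"
      using vsc k by (intro uniform_limit_theorem[OF _ ul[OF k]] always_eventually) (auto simp: cont_vec_def)
  qed
  have dist0: "(\<lambda>n. sqdist N (vs (Suc n)) w) \<longlonglongrightarrow> 0"
  proof (rule tendstoI)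
    fix e :: real assume e: "e > 0"
    \<comment> \<open>\<open>2 * pi * N\<close> comes from summing the constant bound over the
      interval and the components; the extra 1 keeps \<open>B\<close> positive for N = 0 and makes
      the final inequality strict.\<close>
    define B where "B = 2 * pi * real N + 1"
    have B: "B > 0" unfolding B_def by (intro add_nonneg_pos mult_nonneg_nonneg) auto
    define \<delta> where "\<delta> = sqrt (e / B)"
    have \<delta>: "\<delta> > 0" "\<delta>\<^sup>2 = e / B" using e B by (auto simp: \<delta>_def)
    have "\<forall>\<^sub>F n in sequentially. \<forall>k\<in>{1..N}. \<forall>x\<in>Ipi. dist (vs (Suc n) k x) (w k x) < \<delta>"
      by (rule eventually_ball_finite) (auto intro: uniform_limitD[OF ul \<delta>(1)])
    then show "\<forall>\<^sub>F n in sequentially. dist (sqdist N (vs (Suc n)) w) 0 < e"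
    proof eventually_elim
      case (elim n)
      have "integral Ipi (\<lambda>x. (vs (Suc n) k x - w k x)\<^sup>2) \<le> 2 * pi * \<delta>\<^sup>2" if k: "k \<in> {1..N}" for k
      proof -
        have "integral Ipi (\<lambda>x. (vs (Suc n) k x - w k x)\<^sup>2) \<le> integral Ipi (\<lambda>x. \<delta>\<^sup>2)"
        proof (rule integral_le)
          show "(\<lambda>x. (vs (Suc n) k x - w k x)\<^sup>2) integrable_on Ipi"
            using vsc wc k unfolding cont_vec_def
            by (intro integrable_continuous_real continuous_intros) auto
          fix x assume "x \<in> Ipi"
          with elim k have "\<bar>vs (Suc n) k x - w k x\<bar> \<le> \<bar>\<delta>\<bar>"
            using \<delta>(1) by (fastforce simp: dist_real_def)
          then show "(vs (Suc n) k x - w k x)\<^sup>2 \<le> \<delta>\<^sup>2" by (rule abs_le_square_iff[THEN iffD1])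
        qed auto
        then show ?thesis by simp
      qed
      then have "sqdist N (vs (Suc n)) w \<le> (\<Sum>k=1..N. 2 * pi * \<delta>\<^sup>2)"
        unfolding sqdist_def by (rule sum_mono)
      also have "\<dots> < B * \<delta>\<^sup>2" using \<delta>(1) by (simp add: B_def algebra_simps)
      also have "\<dots> = e" using B by (simp add: \<delta>(2))
      finally show ?case by (simp add: dist_real_def)
    qed
  qed
  have "w k x = T w k x" if k: "k \<in> {1..N}" and x: "x \<in> Ipi" for k x
  proof (rule LIMSEQ_unique)
    have "(\<lambda>n. vs (Suc n) k x) \<longlonglongrightarrow> w k x" by (rule tendsto_uniform_limitI[OF ul[OF k] x])
    then show "(\<lambda>n. vs (Suc (Suc n)) k x) \<longlonglongrightarrow> w k x"
      by (rule LIMSEQ_Suc)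
    have "(\<lambda>n. sqrt (C' * sqdist N (vs (Suc n)) w)) \<longlonglongrightarrow> sqrt (C' * 0)"
      by (intro tendsto_intros dist0)
    then have "(\<lambda>n. sqrt (C' * sqdist N (vs (Suc n)) w)) \<longlonglongrightarrow> 0" by simp
    then show "(\<lambda>n. vs (Suc (Suc n)) k x) \<longlonglongrightarrow> T w k x"
    proof (rule LIM_zero_cancel[OF Lim_null_comparison[rotated]])
      have "sqrt ((vs (Suc (Suc n)) k x - T w k x)\<^sup>2) \<le> sqrt (C' * sqdist N (vs (Suc n)) w)" for n
        unfolding vs_Suc[of "Suc n"] by (intro real_sqrt_le_mono smooth' vsc wc k x)
      then show "\<forall>\<^sub>F n in sequentially. norm (vs (Suc (Suc n)) k x - T w k x) \<le> sqrt (C' * sqdist N (vs (Suc n)) w)"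
        by simp
    qed
  qed
  with wc that show ?thesis by (auto simp: eq_on_I_def)
qed

text \<open>Contraction forces the L^2 distance to be 0; the smoothing bound then gives equality of
  the images at every point directly, with no detour through equality almost everywhere.\<close>

lemma smoothing_contraction_unique:
  fixes T :: "(nat \<Rightarrow> real \<Rightarrow> real) \<Rightarrow> nat \<Rightarrow> real \<Rightarrow> real"
  assumes contr: "sqdist N (T u) (T v) \<le> \<theta> * sqdist N u v" and \<theta>: "\<theta> < 1"
    and smooth: "\<And>k x. k \<in> {1..N} \<Longrightarrow> x \<in> Ipi \<Longrightarrow> (T u k x - T v k x)\<^sup>2 \<le> C * sqdist N u v"
    and u: "eq_on_I N u (T u)" and v: "eq_on_I N v (T v)"
  shows "eq_on_I N u v"
proof -
  have "sqdist N (T u) (T v) = sqdist N u v"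
    unfolding sqdist_def
    by (intro sum.cong integral_cong refl) (use u v in \<open>auto simp: eq_on_I_def\<close>)
  with contr have "(1 - \<theta>) * sqdist N u v \<le> 0" by (simp add: algebra_simps)
  with \<theta> have "sqdist N u v \<le> 0" by (simp add: mult_le_0_iff)
  then have "sqdist N u v = 0" by (simp add: order_antisym)
  then have "(T u k x - T v k x)\<^sup>2 \<le> 0" if "k \<in> {1..N}" "x \<in> Ipi" for k x
    using smooth[OF that] by simp
  then have "T u k x = T v k x" if "k \<in> {1..N}" "x \<in> Ipi" for k x
    using that by (simp add: power2_less_eq_zero_iff)
  with u v show ?thesis unfolding eq_on_I_def by simp
qed

section \<open>The nonlinear system\<close>

lemma rhat_le:
  assumes "L2_on f"
  shows "cmod (rhat f n) \<le> sqrt (2*pi * integral Ipi (\<lambda>x. (f x)\<^sup>2))"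
  using bessel_finite[OF assms, of "{n}"] by (intro real_le_rsqrt) simp

lemma rhat_0: "f integrable_on Ipi \<Longrightarrow> rhat f 0 = of_real (integral Ipi f)"
  by (simp add: hat_def integral_of_real_complex)

lemma rhat_eq_integral_exp:
  "rhat f (int m) = integral Ipi (\<lambda>x. complex_of_real (f x) * exp (- \<i> * of_nat m * of_real x))"
  "rhat f (- int m) = integral Ipi (\<lambda>x. complex_of_real (f x) * exp (\<i> * of_nat m * of_real x))"
  using exp_eq_fexp[of "int m"] exp_eq_fexp[of "- int m"] by (simp_all add: hat_def)

text \<open>A real supremum bounds its family only when the range is bounded. Here it is: Bessel
  bounds each coefficient of \<open>G\<close>, and \<open>symb_inverse_bound\<close> bounds the
  inverse symbol.\<close>

lemma cmod_cquot_le_SUP: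
  assumes "L2_on G"
  shows "cmod (cquot (fourier_coeff G n) (symb a b n))
    \<le> (SUP n. cmod (cquot (fourier_coeff G n) (symb a b n)))"
proof (rule cSUP_upper)
  obtain C where C: "C \<ge> 0" "\<And>n. (1 + (of_int n)\<^sup>2) * cmod (cquot 1 (symb a b n)) \<le> C"
    using symb_inverse_bound by metis
  define D where "D = sqrt (2*pi * integral Ipi (\<lambda>x. (G x)\<^sup>2)) / sqrt (2*pi)"
  have "cmod (cquot (fourier_coeff G n) (symb a b n)) \<le> D * C" for n
  proof -
    have "cmod (fourier_coeff G n) \<le> D"
      unfolding fourier_coeff_eq_hat D_def norm_divide
      using rhat_le[OF assms, of n] by (simp add: divide_right_mono)
    moreover have "1 * cmod (cquot 1 (symb a b n)) \<le> (1 + (of_int n)\<^sup>2) * cmod (cquot 1 (symb a b n))"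
      by (intro mult_right_mono) auto
    then have "cmod (cquot 1 (symb a b n)) \<le> C" using C(2)[of n] by linarith
    ultimately have "cmod (fourier_coeff G n) * cmod (cquot 1 (symb a b n)) \<le> D * C"
      using order_trans[OF norm_ge_zero] by (intro mult_mono) auto
    then show ?thesis by (auto simp: cquot_def norm_divide)
  qed
  then show "bdd_above (range (\<lambda>n. cmod (cquot (fourier_coeff G n) (symb a b n))))"
    by (intro bdd_aboveI2)
qed simp

lemma H2_with_cong:
  assumes "H2_with v v1 v2" "\<And>x. x \<in> Ipi \<Longrightarrow> w x = v x"
  shows "H2_with w v1 v2"
proof -
  have "(w has_real_derivative v1 x) (at x within Ipi)" if "x \<in> Ipi" for x
  proof -
    have "(v has_vector_derivative v1 x) (at x within Ipi)"
      using assms(1) that unfolding H2_with_def has_real_derivative_iff_has_vector_derivative by blast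
    then show ?thesis
      unfolding has_real_derivative_iff_has_vector_derivative
      by (rule has_vector_derivative_transform[OF that, rotated]) (rule assms(2))
  qed
  moreover have "w 0 = v 0" "w (2*pi) = v (2*pi)" by (simp_all add: assms(2))
  ultimately show ?thesis using assms(1) unfolding H2_with_def by metis
qed

section \<open>The system under its standing hypotheses, and the map \<open>T\<close> that realises
  tau\<close>

locale integro_system =
  fixes N K l r q :: nat
    and G :: "nat \<Rightarrow> real \<Rightarrow> real"
    and a b :: "nat \<Rightarrow> real"
    and F :: "nat \<Rightarrow> (nat \<Rightarrow> real) \<Rightarrow> real \<Rightarrow> real"
    and h :: "real \<Rightarrow> real"
    and KK L :: real
    and nk :: "nat \<Rightarrow> nat"
  assumes dims: "N \<ge> 5" "K \<ge> 2" "1 \<le> l" "l \<le> K - 1" "K + 1 \<le> r" "r \<le> q - 1"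
      "r + 1 \<le> q" "q \<le> N - 1"
    and G_cont: "\<forall>k\<in>{1..N}. continuous_on Ipi (G k) \<and> G k 0 = G k (2*pi)"
    and b_nz: "\<forall>k\<in>{1..K}. b k \<noteq> 0"
    and F_car: "\<forall>k\<in>{1..N}. caratheodory N (F k)"
    and h_L2: "L2_on h"
    and F_growth: "\<forall>u. \<forall>x\<in>Ipi. sqrt (\<Sum>k=1..N. (F k u x)^2) \<le> KK * enorm N u + h x"
    and L_pos: "L > 0"
    and F_lip: "\<forall>u1 u2. \<forall>x\<in>Ipi.
        sqrt (\<Sum>k=1..N. (F k u1 x - F k u2 x)^2) \<le> L * enorm N (\<lambda>j. u1 j - u2 j)"
    and hyp_a: "\<forall>k\<in>{1..l}. a k > 0"
    and hyp_b: "\<forall>k\<in>{l+1..K}. a k = 0 \<and> integral Ipi (G k) = 0"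
    and hyp_c: "\<forall>k\<in>{K+1..r}. a k > 0 \<and> (\<forall>n::int. a k \<noteq> of_int (n^2))"
    and hyp_d: "\<forall>k\<in>{r+1..q}. a k = of_nat ((nk k)^2)
        \<and> integral Ipi (\<lambda>x. complex_of_real (G k x) * exp (- \<i> * of_nat (nk k) * of_real x)) = 0
        \<and> integral Ipi (\<lambda>x. complex_of_real (G k x) * exp (\<i> * of_nat (nk k) * of_real x)) = 0"
    and hyp_e: "\<forall>k\<in>{q+1..N}. a k = 0 \<and> integral Ipi (G k) = 0"
    and small: "2 * sqrt pi * Qconst N K G a b * L < 1"
begin

text \<open>The drift extended by 0, so that the equations for k \<le> K and for k > K share one
  symbol.\<close>

definition b' :: "nat \<Rightarrow> real" where
  "b' k = (if k \<le> K then b k else 0)"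

definition rhs :: "(nat \<Rightarrow> real \<Rightarrow> real) \<Rightarrow> nat \<Rightarrow> real \<Rightarrow> real" where
  "rhs v k y = F k (\<lambda>j. v j y) y"

definition T :: "(nat \<Rightarrow> real \<Rightarrow> real) \<Rightarrow> nat \<Rightarrow> real \<Rightarrow> real" where
  "T v k = sol (G k) (a k) (b' k) (rhs v k)"

lemma G: "k \<in> {1..N} \<Longrightarrow> continuous_on Ipi (G k)" "k \<in> {1..N} \<Longrightarrow> G k 0 = G k (2*pi)"
  "k \<in> {1..N} \<Longrightarrow> L2_on (G k)"
  using G_cont L2_on_continuous by auto

lemma conv_term_eq: "conv_term G F k v x = integral Ipi (\<lambda>y. per_ext (G k) (x - y) * rhs v k y)"
  by (simp add: conv_term_def rhs_def)

lemma tau_rel_iff: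
  "tau_rel N K a b G F v u \<longleftrightarrow>
     (\<forall>k\<in>{1..N}. \<exists>u1 u2 Z. H2_with (u k) u1 u2 \<and> Z \<in> null_sets lebesgue \<and>
        (\<forall>x\<in>Ipi - Z. - u2 x - b' k * u1 x - a k * u k x = conv_term G F k v x))"
  unfolding tau_rel_def b'_def
  by (intro ball_cong refl ex_cong1 conj_cong) auto

lemma solves_system_iff: "solves_system N K a b G F u \<longleftrightarrow> tau_rel N K a b G F u u"
  unfolding solves_system_def tau_rel_def
  by (intro ball_cong refl ex_cong1 conj_cong imp_cong) (auto simp: algebra_simps add_eq_0_iff)

lemma F_lipschitz:
  assumes "k \<in> {1..N}" "x \<in> Ipi"
  shows "\<bar>F k u1 x - F k u2 x\<bar> \<le> L * enorm N (\<lambda>j. u1 j - u2 j)"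
proof -
  have "(F k u1 x - F k u2 x)\<^sup>2 \<le> (\<Sum>k=1..N. (F k u1 x - F k u2 x)\<^sup>2)"
    using assms by (intro member_le_sum) auto
  then have "sqrt ((F k u1 x - F k u2 x)\<^sup>2) \<le> sqrt (\<Sum>k=1..N. (F k u1 x - F k u2 x)\<^sup>2)"
    by (rule real_sqrt_le_mono)
  also have "\<dots> \<le> L * enorm N (\<lambda>j. u1 j - u2 j)" using F_lip assms by blast
  finally show ?thesis by simp
qed

lemma F_bound:
  assumes "k \<in> {1..N}" "x \<in> Ipi"
  shows "\<bar>F k u x\<bar> \<le> KK * enorm N u + h x"
proof -
  have "(F k u x)\<^sup>2 \<le> (\<Sum>k=1..N. (F k u x)\<^sup>2)"
    using assms by (intro member_le_sum) auto
  then have "sqrt ((F k u x)\<^sup>2) \<le> sqrt (\<Sum>k=1..N. (F k u x)\<^sup>2)"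
    by (rule real_sqrt_le_mono)
  also have "\<dots> \<le> KK * enorm N u + h x" using F_growth assms by blast
  finally show ?thesis by simp
qed

lemma rhs_L2:
  assumes "cont_vec N v" "k \<in> {1..N}"
  shows "L2_on (rhs v k)"
  unfolding rhs_def[abs_def]
proof (rule nemytskii_L2[where f = "F k" and v = v and L = L and K = KK and N = N and h = h])
  show "F k u \<in> borel_measurable (lebesgue_on Ipi)" for u
    using F_car assms unfolding caratheodory_def by blast
qed (use assms h_L2 F_lipschitz F_bound in \<open>auto simp: cont_vec_def\<close>)

text \<open>Vectors are functions on all naturals, and \<open>F k\<close> could a priori see
  components outside 1..N. The Lipschitz condition excludes this, as \<open>enorm N\<close> ignores
  them.\<close>

lemma rhs_cong:
  assumes "eq_on_I N u v" "k \<in> {1..N}" "y \<in> Ipi"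
  shows "rhs u k y = rhs v k y"
proof -
  have "enorm N (\<lambda>j. u j y - v j y) = 0"
    using assms unfolding enorm_def eq_on_I_def by simp
  then show ?thesis
    using F_lipschitz[OF assms(2,3), of "\<lambda>j. u j y" "\<lambda>j. v j y"] by (simp add: rhs_def)
qed

lemma conv_term_cong:
  assumes "eq_on_I N u v" "k \<in> {1..N}"
  shows "conv_term G F k u x = conv_term G F k v x"
  unfolding conv_term_eq by (intro integral_cong) (simp add: rhs_cong[OF assms])

text \<open>Both the convolution term and \<open>H2_with\<close> see functions only through their
  values on the interval, so the derivatives and the null set can be kept. This permits working with
  functions identified by \<open>eq_on_I\<close>.\<close>

lemma tau_rel_cong:
  assumes "eq_on_I N u v" "eq_on_I N u' v'" "tau_rel N K a b G F v v'"
  shows "tau_rel N K a b G F u u'"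
  unfolding tau_rel_iff
proof
  fix k assume k: "k \<in> {1..N}"
  then obtain u1 u2 Z where *: "H2_with (v' k) u1 u2" "Z \<in> null_sets lebesgue"
    "\<forall>x\<in>Ipi - Z. - u2 x - b' k * u1 x - a k * v' k x = conv_term G F k v x"
    using assms(3) unfolding tau_rel_iff by blast
  have eq: "u' k x = v' k x" if "x \<in> Ipi" for x
    using assms(2) k that unfolding eq_on_I_def by blast
  have "H2_with (u' k) u1 u2" by (rule H2_with_cong[OF *(1) eq])
  moreover have "\<forall>x\<in>Ipi - Z. - u2 x - b' k * u1 x - a k * u' k x = conv_term G F k u x"
    using *(3) eq conv_term_cong[OF assms(1) k] by simp
  ultimately show "\<exists>u1 u2 Z. H2_with (u' k) u1 u2 \<and> Z \<in> null_sets lebesgue \<and>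
      (\<forall>x\<in>Ipi - Z. - u2 x - b' k * u1 x - a k * u' k x = conv_term G F k u x)"
    using *(2) by blast
qed

text \<open>The orthogonality conditions imposed on \<open>G\<close> and on the function space both say that the
  Fourier coefficients vanish at the zeros of the symbol.\<close>

lemma orthogonality_iff:
  assumes k: "k \<in> {1..N}" and f: "f integrable_on Ipi"
  shows "(\<forall>n. symb (a k) (b' k) n = 0 \<longrightarrow> rhat f n = 0) \<longleftrightarrow>
      (k \<in> {l+1..K} \<union> {q+1..N} \<longrightarrow> integral Ipi f = 0)
        \<and> (k \<in> {r+1..q} \<longrightarrow>
              integral Ipi (\<lambda>x. complex_of_real (f x) * exp (- \<i> * of_nat (nk k) * of_real x)) = 0
            \<and> integral Ipi (\<lambda>x. complex_of_real (f x) * exp (\<i> * of_nat (nk k) * of_real x)) = 0)"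
proof -
  have symb0: "symb (a k) (b' k) n = 0 \<longleftrightarrow> (real_of_int n)\<^sup>2 = a k \<and> b' k * real_of_int n = 0" for n
    by (auto simp: symb_def complex_eq_iff)
  \<comment> \<open>The zero sets of the symbol are, in this order: empty (a > 0 forces n \<noteq>
    0, the drift forces n = 0), {0}, empty, {n_k, -n_k}, {0}.\<close>
  consider "k \<in> {1..l}" | "k \<in> {l+1..K}" | "k \<in> {K+1..r}" | "k \<in> {r+1..q}" | "k \<in> {q+1..N}"
    using k by fastforce
  then show ?thesis
  proof cases
    case 1
    then have "a k > 0" "b' k \<noteq> 0" "k \<notin> {l+1..K} \<union> {q+1..N}" "k \<notin> {r+1..q}"
      using hyp_a b_nz dims by (auto simp: b'_def)
    moreover from this have "symb (a k) (b' k) n \<noteq> 0" for n unfolding symb0 by auto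
    ultimately show ?thesis by auto
  next
    case 2
    then have "a k = 0" "b' k \<noteq> 0" "k \<in> {l+1..K} \<union> {q+1..N}" "k \<notin> {r+1..q}"
      using hyp_b b_nz dims by (auto simp: b'_def)
    moreover from this have "symb (a k) (b' k) n = 0 \<longleftrightarrow> n = 0" for n unfolding symb0 by auto
    ultimately show ?thesis using rhat_0[OF f] by auto
  next
    case 3
    then have "\<forall>n::int. a k \<noteq> of_int (n^2)" "k \<notin> {l+1..K} \<union> {q+1..N}" "k \<notin> {r+1..q}"
      using hyp_c dims by auto
    moreover from this have "symb (a k) (b' k) n \<noteq> 0" for n unfolding symb0 by (metis of_int_power)
    ultimately show ?thesis by auto
  next
    case 4
    then have "a k = (real (nk k))\<^sup>2" "b' k = 0" "k \<notin> {l+1..K} \<union> {q+1..N}" "k \<in> {r+1..q}"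
      using hyp_d dims by (auto simp: b'_def)
    moreover from this have "symb (a k) (b' k) n = 0 \<longleftrightarrow> n = int (nk k) \<or> n = - int (nk k)" for n
    proof -
      have "(real_of_int n)\<^sup>2 = (real (nk k))\<^sup>2 \<longleftrightarrow> real_of_int (n\<^sup>2) = real_of_int ((int (nk k))\<^sup>2)"
        by simp
      also have "\<dots> \<longleftrightarrow> n\<^sup>2 = (int (nk k))\<^sup>2" by (rule of_int_eq_iff)
      also have "\<dots> \<longleftrightarrow> n = int (nk k) \<or> n = - int (nk k)" by (rule power2_eq_iff)
      finally show ?thesis unfolding symb0 using \<open>a k = _\<close> \<open>b' k = 0\<close> by simp
    qed
    ultimately show ?thesis unfolding rhat_eq_integral_exp[symmetric] by auto
  next
    case 5
    then have "a k = 0" "b' k = 0" "k \<in> {l+1..K} \<union> {q+1..N}" "k \<notin> {r+1..q}"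
      using hyp_e dims by (auto simp: b'_def)
    moreover from this have "symb (a k) (b' k) n = 0 \<longleftrightarrow> n = 0" for n unfolding symb0 by auto
    ultimately show ?thesis using rhat_0[OF f] by auto
  qed
qed

lemma G_orthogonal:
  assumes k: "k \<in> {1..N}" and "symb (a k) (b' k) n = 0"
  shows "rhat (G k) n = 0"
proof -
  have "G k integrable_on Ipi" by (intro integrable_continuous_real G k)
  from orthogonality_iff[OF k this] hyp_b hyp_d hyp_e assms(2) show ?thesis by blast
qed

lemma H2_continuous: "H2 v \<Longrightarrow> continuous_on Ipi v"
  unfolding H2_def using H2_with_continuous by blast

lemma H2_periodic: "H2 v \<Longrightarrow> v 0 = v (2*pi)"
  unfolding H2_def H2_with_def by blast

lemma H2c_iff:
  "H2c N K l r q nk u \<longleftrightarrow>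
    (\<forall>k\<in>{1..N}. H2 (u k) \<and> (\<forall>n. symb (a k) (b' k) n = 0 \<longrightarrow> rhat (u k) n = 0))"
  unfolding H2c_def
  by (intro ball_cong refl conj_cong orthogonality_iff[symmetric] integrable_continuous_real H2_continuous)

lemma H2c_cont_vec: "H2c N K l r q nk u \<Longrightarrow> cont_vec N u"
  unfolding H2c_def cont_vec_def using H2_continuous by blast

lemma rhat_T:
  assumes "cont_vec N v" "k \<in> {1..N}"
  shows "rhat (T v k) n = cquot (rhat (G k) n) (symb (a k) (b' k) n) * rhat (rhs v k) n"
  using rhat_sol[OF G(3)[OF assms(2)] rhs_L2[OF assms], of "a k" "b' k" n]
  by (simp add: T_def scoef_def)

lemma T_cont_vec: "cont_vec N v \<Longrightarrow> cont_vec N (T v)"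
  unfolding cont_vec_def[of N "T v"] T_def using rhs_L2 G(3) continuous_on_sol by blast

lemma T_solves:
  assumes v: "cont_vec N v"
  shows "H2c N K l r q nk (T v)" "tau_rel N K a b G F v (T v)"
proof -
  have *: "\<exists>u1 u2. H2_with (T v k) u1 u2 \<and>
      (\<forall>x. - u2 x - b' k * u1 x - a k * T v k x = conv_term G F k v x)" if k: "k \<in> {1..N}" for k
  proof -
    obtain u1 u2 where "H2_with (sol (G k) (a k) (b' k) (rhs v k)) u1 u2"
      "\<And>x. - u2 x - b' k * u1 x - a k * sol (G k) (a k) (b' k) (rhs v k) x
        = integral Ipi (\<lambda>y. per_ext (G k) (x - y) * rhs v k y)"
      by (rule sol_solves[OF G(1,2)[OF k] rhs_L2[OF v k] G_orthogonal[OF k]]) (assumption, rule that)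
    then show ?thesis unfolding T_def conv_term_eq by blast
  qed
  then show "H2c N K l r q nk (T v)"
    unfolding H2c_iff H2_def by (metis rhat_T[OF v] cquot_def mult_zero_left)
  show "tau_rel N K a b G F v (T v)"
    unfolding tau_rel_iff
  proof
    fix k assume "k \<in> {1..N}"
    from *[OF this] obtain u1 u2 where "H2_with (T v k) u1 u2"
      "\<forall>x. - u2 x - b' k * u1 x - a k * T v k x = conv_term G F k v x" by blast
    then show "\<exists>u1 u2 Z. H2_with (T v k) u1 u2 \<and> Z \<in> null_sets lebesgue \<and>
        (\<forall>x\<in>Ipi - Z. - u2 x - b' k * u1 x - a k * T v k x = conv_term G F k v x)"
      using null_sets.empty_sets by blast
  qed
qed

text \<open>Compare coefficients: where the symbol is nonzero the equation determines them by
  division, and at its zeros they vanish for \<open>u\<close> by membership in the space and for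
  \<open>T v\<close> by the convention in \<open>cquot\<close>.\<close>

lemma tau_rel_unique:
  assumes v: "cont_vec N v" and u: "H2c N K l r q nk u" "tau_rel N K a b G F v u"
  shows "eq_on_I N u (T v)"
  unfolding eq_on_I_def
proof (intro ballI)
  fix k x assume k: "k \<in> {1..N}" and x: "x \<in> Ipi"
  obtain u1 u2 Z where *: "H2_with (u k) u1 u2" "Z \<in> null_sets lebesgue"
    "\<And>x. x \<in> Ipi - Z \<Longrightarrow> - u2 x - b' k * u1 x - a k * u k x = conv_term G F k v x"
    using u(2) k unfolding tau_rel_iff by blast
  note conv = conv_continuous[OF G(1,2)[OF k] rhs_L2[OF v k], folded conv_term_eq]
  have "symb (a k) (b' k) n * rhat (u k) n = rhat (G k) n * rhat (rhs v k) n" for n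
    using H2_with_equation_rhat[OF * conv(1)] conv(2) by simp
  moreover have "rhat (u k) n = 0" if "symb (a k) (b' k) n = 0" for n
    using u(1) k that unfolding H2c_iff by blast
  ultimately have eq: "rhat (u k) n = rhat (T v k) n" for n
    unfolding rhat_T[OF v k] by (auto simp: cquot_def field_simps)
  have "H2 (T v k)" using T_solves(1)[OF v] k unfolding H2c_def by blast
  moreover have "H2 (u k)" using *(1) unfolding H2_def by blast
  ultimately show "u k x = T v k x"
    by (intro eq_of_rhat_eq[OF _ _ _ _ eq x]) (simp_all only: H2_continuous H2_periodic)
qed

section \<open>Contraction and smoothing estimates for \<open>T\<close>, and its fixed point\<close>

lemma Qconst_bound:
  assumes k: "k \<in> {1..N}"
  shows "cmod (cquot (fourier_coeff (G k) n) (symb (a k) (b' k) n)) \<le> Qconst N K G a b"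
proof (cases "k \<le> K")
  case True
  have "cmod (cquot (fourier_coeff (G k) n) (symb (a k) (b' k) n)) \<le> N_ab G a b k"
    using cmod_cquot_le_SUP[OF G(3)[OF k], of n "a k" "b k"] True
    unfolding N_ab_def symb_def b'_def by (simp add: max.coboundedI1)
  also have "\<dots> \<le> Max (N_ab G a b ` {1..K})" using True k by (intro Max_ge) auto
  also have "\<dots> \<le> Qconst N K G a b" unfolding Qconst_def by simp
  finally show ?thesis .
next
  case False
  have "cmod (cquot (fourier_coeff (G k) n) (symb (a k) (b' k) n)) \<le> M_a G a k"
    using cmod_cquot_le_SUP[OF G(3)[OF k], of n "a k" 0] False
    unfolding M_a_def symb_def b'_def by (simp add: max.coboundedI1)
  also have "\<dots> \<le> Max (M_a G a ` {K+1..N})" using False k by (intro Max_ge) auto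
  also have "\<dots> \<le> Qconst N K G a b" unfolding Qconst_def by simp
  finally show ?thesis .
qed

lemma Qconst_nonneg: "0 \<le> Qconst N K G a b"
  using Qconst_bound[of 1] dims norm_ge_zero order_trans by (metis atLeastAtMost_iff le_trans le_refl one_le_numeral)

definition \<theta> :: real where
  "\<theta> = 2*pi * (Qconst N K G a b)\<^sup>2 * L\<^sup>2"

lemma theta: "0 \<le> \<theta>" "\<theta> < 1"
proof -
  show "0 \<le> \<theta>" by (simp add: \<theta>_def)
  \<comment> \<open>Squaring requires the left side to be nonnegative, hence
    \<open>Qconst_nonneg\<close>. The result says 2 * \<open>\<theta>\<close> < 1.\<close>
  have "(2 * sqrt pi * Qconst N K G a b * L)\<^sup>2 < 1\<^sup>2"
    using small Qconst_nonneg L_pos by (intro power_strict_mono) auto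
  then have "4 * pi * (Qconst N K G a b)\<^sup>2 * L\<^sup>2 < 1" by (simp add: power_mult_distrib)
  moreover have "4 * pi * (Qconst N K G a b)\<^sup>2 * L\<^sup>2 = 2 * \<theta>" by (simp add: \<theta>_def)
  ultimately show "\<theta> < 1" using \<open>0 \<le> \<theta>\<close> by linarith
qed

text \<open>The Lipschitz condition couples the components, so it can be applied only after the sum
  over k has been moved under the integral.\<close>

lemma rhs_sqdist:
  assumes u: "cont_vec N u" and v: "cont_vec N v"
  shows "(\<Sum>k=1..N. integral Ipi (\<lambda>x. (rhs u k x - rhs v k x)\<^sup>2)) \<le> L\<^sup>2 * sqdist N u v"
proof -
  have int: "(\<lambda>x. (rhs u k x - rhs v k x)\<^sup>2) integrable_on Ipi" if "k \<in> {1..N}" for k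
    using L2_on_diff[OF rhs_L2[OF u that] rhs_L2[OF v that]] by (simp add: L2_on_def)
  have int': "(\<lambda>x. (u k x - v k x)\<^sup>2) integrable_on Ipi" if "k \<in> {1..N}" for k
    using u v that unfolding cont_vec_def by (intro integrable_continuous_real continuous_intros) auto
  have "(\<Sum>k=1..N. integral Ipi (\<lambda>x. (rhs u k x - rhs v k x)\<^sup>2))
      = integral Ipi (\<lambda>x. \<Sum>k=1..N. (rhs u k x - rhs v k x)\<^sup>2)"
    using int by (intro integral_sum[symmetric]) auto
  also have "\<dots> \<le> integral Ipi (\<lambda>x. L\<^sup>2 * (\<Sum>k=1..N. (u k x - v k x)\<^sup>2))"
  proof (rule integral_le)
    show "(\<lambda>x. \<Sum>k=1..N. (rhs u k x - rhs v k x)\<^sup>2) integrable_on Ipi"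
      using int by (intro integrable_sum) auto
    show "(\<lambda>x. L\<^sup>2 * (\<Sum>k=1..N. (u k x - v k x)\<^sup>2)) integrable_on Ipi"
      using int' by (intro integrable_on_mult_right integrable_sum) auto
    fix x assume "x \<in> Ipi"
    then have "sqrt (\<Sum>k=1..N. (rhs u k x - rhs v k x)\<^sup>2) \<le> L * enorm N (\<lambda>j. u j x - v j x)"
      using F_lip unfolding rhs_def by blast
    then have "(sqrt (\<Sum>k=1..N. (rhs u k x - rhs v k x)\<^sup>2))\<^sup>2 \<le> (L * enorm N (\<lambda>j. u j x - v j x))\<^sup>2"
      by (intro power_mono) (auto intro: sum_nonneg)
    then show "(\<Sum>k=1..N. (rhs u k x - rhs v k x)\<^sup>2) \<le> L\<^sup>2 * (\<Sum>k=1..N. (u k x - v k x)\<^sup>2)"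
      by (simp add: sum_nonneg power_mult_distrib enorm_square)
  qed
  also have "\<dots> = L\<^sup>2 * sqdist N u v"
    unfolding sqdist_def integral_mult_right using int' by (subst integral_sum) auto
  finally show ?thesis .
qed

lemma T_diff:
  assumes "cont_vec N u" "cont_vec N v" "k \<in> {1..N}"
  shows "T u k x - T v k x = sol (G k) (a k) (b' k) (\<lambda>y. rhs u k y - rhs v k y) x"
  unfolding T_def by (intro sol_diff G rhs_L2 assms)

lemma T_contraction:
  assumes u: "cont_vec N u" and v: "cont_vec N v"
  shows "sqdist N (T u) (T v) \<le> \<theta> * sqdist N u v"
proof -
  let ?Q = "Qconst N K G a b"
  have "sqdist N (T u) (T v)
      \<le> (\<Sum>k=1..N. 2*pi * ?Q\<^sup>2 * integral Ipi (\<lambda>x. (rhs u k x - rhs v k x)\<^sup>2))"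
    unfolding sqdist_def
  proof (rule sum_mono)
    fix k assume k: "k \<in> {1..N}"
    show "integral Ipi (\<lambda>x. (T u k x - T v k x)\<^sup>2)
        \<le> 2*pi * ?Q\<^sup>2 * integral Ipi (\<lambda>x. (rhs u k x - rhs v k x)\<^sup>2)"
      unfolding T_diff[OF u v k]
      by (intro integral_square_sol_le L2_on_diff rhs_L2 G u v k Qconst_bound)
  qed
  also have "\<dots> \<le> 2*pi * ?Q\<^sup>2 * (L\<^sup>2 * sqdist N u v)"
    unfolding sum_distrib_left[symmetric] by (intro mult_left_mono rhs_sqdist u v) auto
  finally show ?thesis by (simp add: \<theta>_def mult_ac)
qed

text \<open>Each component has its own constant from \<open>sol_sup_bound\<close>; their sum serves
  all k at once.\<close>

lemma T_smoothing:
  obtains C where "\<And>u v k x. cont_vec N u \<Longrightarrow> cont_vec N v \<Longrightarrow> k \<in> {1..N} \<Longrightarrow>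
      (T u k x - T v k x)\<^sup>2 \<le> C * sqdist N u v"
proof -
  have "\<exists>C\<ge>0. \<forall>f x. L2_on f \<longrightarrow> (sol (G k) (a k) (b' k) f x)\<^sup>2 \<le> C * integral Ipi (\<lambda>x. (f x)\<^sup>2)"
    if "k \<in> {1..N}" for k
    using sol_sup_bound[OF G(3)[OF that], of "a k" "b' k"] by metis
  then obtain C where C: "\<And>k. k \<in> {1..N} \<Longrightarrow> C k \<ge> 0"
    "\<And>k f x. k \<in> {1..N} \<Longrightarrow> L2_on f \<Longrightarrow> (sol (G k) (a k) (b' k) f x)\<^sup>2 \<le> C k * integral Ipi (\<lambda>x. (f x)\<^sup>2)"
    by metis
  have "(T u k x - T v k x)\<^sup>2 \<le> ((\<Sum>k=1..N. C k) * L\<^sup>2) * sqdist N u v"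
    if u: "cont_vec N u" and v: "cont_vec N v" and k: "k \<in> {1..N}" for u v k x
  proof -
    let ?I = "\<lambda>k. integral Ipi (\<lambda>x. (rhs u k x - rhs v k x)\<^sup>2)"
    have I: "?I j \<ge> 0" if "j \<in> {1..N}" for j
      using L2_on_diff[OF rhs_L2[OF u that] rhs_L2[OF v that]] by (auto simp: L2_on_def intro: integral_nonneg)
    have "(T u k x - T v k x)\<^sup>2 \<le> C k * ?I k"
      unfolding T_diff[OF u v k] by (intro C L2_on_diff rhs_L2 u v k)
    also have "\<dots> \<le> (\<Sum>k=1..N. C k) * (\<Sum>k=1..N. ?I k)"
      using C(1) I k by (intro mult_mono member_le_sum sum_nonneg) auto
    also have "\<dots> \<le> (\<Sum>k=1..N. C k) * (L\<^sup>2 * sqdist N u v)"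
      using C(1) by (intro mult_left_mono rhs_sqdist u v sum_nonneg)
    finally show ?thesis by (simp add: mult.assoc)
  qed
  then show ?thesis by (rule that)
qed

text \<open>The abstract fixed point \<open>w\<close> is known only to be continuous, so
  \<open>T w\<close>, which lies in the right space, is taken instead. It solves the equation with
  data \<open>w\<close>, hence with data \<open>T w\<close>, and uniqueness for the linear equation
  identifies it with \<open>T (T w)\<close>.\<close>

lemma fixed_point:
  obtains v0 where "H2c N K l r q nk v0" "eq_on_I N v0 (T v0)"
    "\<And>w. cont_vec N w \<Longrightarrow> eq_on_I N w (T w) \<Longrightarrow> eq_on_I N w v0"
proof -
  obtain C where C: "\<And>u v k x. cont_vec N u \<Longrightarrow> cont_vec N v \<Longrightarrow> k \<in> {1..N} \<Longrightarrow>
      (T u k x - T v k x)\<^sup>2 \<le> C * sqdist N u v"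
    using T_smoothing by blast
  obtain w where w: "cont_vec N w" "eq_on_I N w (T w)"
    by (rule smoothing_contraction_fixed_point[of N T \<theta> C])
       (auto intro: T_cont_vec T_contraction theta C)
  let ?v = "T w"
  have v: "cont_vec N ?v" by (rule T_cont_vec[OF w(1)])
  have "tau_rel N K a b G F w ?v" by (rule T_solves[OF w(1)])
  then have "tau_rel N K a b G F ?v ?v"
    by (rule tau_rel_cong[rotated 2]) (use w(2) in \<open>auto simp: eq_on_I_def\<close>)
  then have v_fix: "eq_on_I N ?v (T ?v)"
    by (intro tau_rel_unique v T_solves w)
  moreover have "eq_on_I N w' ?v" if "cont_vec N w'" "eq_on_I N w' (T w')" for w'
    by (rule smoothing_contraction_unique[where T = T, OF T_contraction theta(2) C])
       (use that v v_fix in auto)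
  ultimately show ?thesis using that[of ?v] T_solves(1)[OF w(1)] by blast
qed

text \<open>A vanishing quotient in \<open>rhat_T\<close> means that the coefficient of
  \<open>G k\<close> is 0 or the symbol is 0, and the second case implies the first by
  \<open>G_orthogonal\<close>.\<close>

lemma zero_fixed_point:
  assumes v: "cont_vec N v" "eq_on_I N v (T v)" and zero: "\<forall>k\<in>{1..N}. \<forall>x\<in>Ipi. v k x = 0"
    and k: "k \<in> {1..N}"
  shows "fourier_coeff (G k) n * fourier_coeff (F k (\<lambda>j. 0)) n = 0"
proof -
  have "rhat (T v k) n = integral Ipi (\<lambda>x. 0)"
    unfolding hat_def by (intro integral_cong) (use v(2) zero k in \<open>auto simp: eq_on_I_def\<close>)
  then have "cquot (rhat (G k) n) (symb (a k) (b' k) n) * rhat (rhs v k) n = 0"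
    unfolding rhat_T[OF v(1) k] by simp
  then have "rhat (G k) n * rhat (rhs v k) n = 0"
    using G_orthogonal[OF k, of n] by (auto simp: cquot_def split: if_splits)
  moreover have "rhat (rhs v k) n = rhat (F k (\<lambda>j. 0)) n"
  proof -
    have "rhs v k y = rhs (\<lambda>j x. 0) k y" if "y \<in> Ipi" for y
      using zero by (intro rhs_cong k that) (auto simp: eq_on_I_def)
    then show ?thesis unfolding hat_def by (intro integral_cong) (simp add: rhs_def)
  qed
  ultimately show ?thesis by (auto simp: fourier_coeff_eq_hat)
qed

end

theorem theorem2p3:
  fixes N K l r q :: nat
    and G :: "nat \<Rightarrow> real \<Rightarrow> real"
    and a b :: "nat \<Rightarrow> real"
    and F :: "nat \<Rightarrow> (nat \<Rightarrow> real) \<Rightarrow> real \<Rightarrow> real"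
    and h :: "real \<Rightarrow> real"
    and KK L :: real
    and nk :: "nat \<Rightarrow> nat"
  assumes dims: "N \<ge> 5" "K \<ge> 2" "1 \<le> l" "l \<le> K - 1" "K + 1 \<le> r" "r \<le> q - 1"
      "r + 1 \<le> q" "q \<le> N - 1"
    and G_cont: "\<forall>k\<in>{1..N}. continuous_on Ipi (G k) \<and> G k 0 = G k (2*pi)"
    and a_nonneg: "\<forall>k\<in>{1..N}. a k \<ge> 0"
    and b_nz: "\<forall>k\<in>{1..K}. b k \<noteq> 0"
    and F_car: "\<forall>k\<in>{1..N}. caratheodory N (F k)"
    and F_per: "\<forall>k\<in>{1..N}. \<forall>u. F k u 0 = F k u (2*pi)"
    and KK_pos: "KK > 0"
    and h_L2: "L2_on h" and h_nonneg: "\<forall>x\<in>Ipi. h x \<ge> 0"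
    and F_growth: "\<forall>u. \<forall>x\<in>Ipi. sqrt (\<Sum>k=1..N. (F k u x)^2) \<le> KK * enorm N u + h x"
    and L_pos: "L > 0"
    and F_lip: "\<forall>u1 u2. \<forall>x\<in>Ipi.
        sqrt (\<Sum>k=1..N. (F k u1 x - F k u2 x)^2) \<le> L * enorm N (\<lambda>j. u1 j - u2 j)"
    and hyp_a: "\<forall>k\<in>{1..l}. a k > 0"
    and hyp_b: "\<forall>k\<in>{l+1..K}. a k = 0 \<and> integral Ipi (G k) = 0"
    and hyp_c: "\<forall>k\<in>{K+1..r}. a k > 0 \<and> (\<forall>n::int. a k \<noteq> of_int (n^2))"
    and hyp_d: "\<forall>k\<in>{r+1..q}. a k = of_nat ((nk k)^2)
        \<and> integral Ipi (\<lambda>x. complex_of_real (G k x) * exp (- \<i> * of_nat (nk k) * of_real x)) = 0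
        \<and> integral Ipi (\<lambda>x. complex_of_real (G k x) * exp (\<i> * of_nat (nk k) * of_real x)) = 0"
    and hyp_e: "\<forall>k\<in>{q+1..N}. a k = 0 \<and> integral Ipi (G k) = 0"
    and small: "2 * sqrt pi * Qconst N K G a b * L < 1"
  shows "(\<forall>v. H2c N K l r q nk v \<longrightarrow>
            (\<exists>u. H2c N K l r q nk u \<and> tau_rel N K a b G F v u \<and>
               (\<forall>u'. H2c N K l r q nk u' \<and> tau_rel N K a b G F v u' \<longrightarrow> eq_on_I N u' u)))
       \<and> (\<exists>v0. H2c N K l r q nk v0 \<and> tau_rel N K a b G F v0 v0
            \<and> (\<forall>w. H2c N K l r q nk w \<and> tau_rel N K a b G F w w \<longrightarrow> eq_on_I N w v0)
            \<and> (\<forall>w. H2c N K l r q nk w \<longrightarrow> (solves_system N K a b G F w \<longleftrightarrow> eq_on_I N w v0))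
            \<and> ((\<exists>k\<in>{1..N}. \<exists>n::int. fourier_coeff (G k) n * fourier_coeff (F k (\<lambda>j. 0)) n \<noteq> 0)
                 \<longrightarrow> \<not> (\<forall>k\<in>{1..N}. \<forall>x\<in>Ipi. v0 k x = 0)))"
proof -
  interpret integro_system N K l r q G a b F h KK L nk
    using assms by unfold_locales
  obtain v0 where v0: "H2c N K l r q nk v0" "eq_on_I N v0 (T v0)"
    "\<And>w. cont_vec N w \<Longrightarrow> eq_on_I N w (T w) \<Longrightarrow> eq_on_I N w v0"
    using fixed_point by blast
  have v0c: "cont_vec N v0" by (rule H2c_cont_vec[OF v0(1)])
  have tau0: "tau_rel N K a b G F v0 v0"
    by (rule tau_rel_cong[OF _ v0(2) T_solves(2)[OF v0c]]) (simp add: eq_on_I_def)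
  \<comment> \<open>\<open>tau_rel_unique\<close> with data \<open>w\<close> turns the relation of
    \<open>w\<close> to itself into a fixed point equation for \<open>T\<close>.\<close>
  have uniq: "eq_on_I N w v0" if "H2c N K l r q nk w" "tau_rel N K a b G F w w" for w
    using that H2c_cont_vec tau_rel_unique v0(3) by blast
  have sol: "\<exists>u. H2c N K l r q nk u \<and> tau_rel N K a b G F v u \<and>
      (\<forall>u'. H2c N K l r q nk u' \<and> tau_rel N K a b G F v u' \<longrightarrow> eq_on_I N u' u)"
    if "H2c N K l r q nk v" for v
    using T_solves[OF H2c_cont_vec[OF that]] tau_rel_unique[OF H2c_cont_vec[OF that]] by blast
  have sys: "solves_system N K a b G F w \<longleftrightarrow> eq_on_I N w v0" if "H2c N K l r q nk w" for w
    unfolding solves_system_iff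
  proof
    assume eq: "eq_on_I N w v0"
    show "tau_rel N K a b G F w w" by (rule tau_rel_cong[OF eq eq tau0])
  qed (rule uniq[OF that])
  have nz: "\<not> (\<forall>k\<in>{1..N}. \<forall>x\<in>Ipi. v0 k x = 0)"
    if "\<exists>k\<in>{1..N}. \<exists>n::int. fourier_coeff (G k) n * fourier_coeff (F k (\<lambda>j. 0)) n \<noteq> 0"
  proof
    assume zero: "\<forall>k\<in>{1..N}. \<forall>x\<in>Ipi. v0 k x = 0"
    from that zero_fixed_point[OF v0c v0(2) zero] show False by blast
  qed
  show ?thesis
  proof (rule conjI)
    show "\<exists>v0. H2c N K l r q nk v0 \<and> tau_rel N K a b G F v0 v0
            \<and> (\<forall>w. H2c N K l r q nk w \<and> tau_rel N K a b G F w w \<longrightarrow> eq_on_I N w v0)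
            \<and> (\<forall>w. H2c N K l r q nk w \<longrightarrow> (solves_system N K a b G F w \<longleftrightarrow> eq_on_I N w v0))
            \<and> ((\<exists>k\<in>{1..N}. \<exists>n::int. fourier_coeff (G k) n * fourier_coeff (F k (\<lambda>j. 0)) n \<noteq> 0)
                 \<longrightarrow> \<not> (\<forall>k\<in>{1..N}. \<forall>x\<in>Ipi. v0 k x = 0))"
      by (rule exI[of _ v0], intro conjI allI impI; (elim conjE)?) (rule v0(1) tau0 uniq sys nz; assumption)+
  qed (intro allI impI sol)
qed

end
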